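(* Let $p\in\mathbb N$ with $\rho:=(p+1)\alpha>1$, let $F_a\in C_b^{p+1}(\mathbb R^e;\mathbb R^e)$ for $a\in\mathcal A=\{1,\dots,m\}$, and let $Z:[0,T]\to\mathbb R^m$ be the path component of an $\mathbf X$-controlled rough path (in particular $Z$ is $\alpha$-Hölder). Assume that the simplified controlled Runge-Kutta method with tableau $(A,b)$, $A\in\mathbb R^{q\times q}$, $b\in\mathbb R^q$, has solvable stage systems at each step and has tree order $p$, i.e. $\widehat a(\tau)=1/\gamma(\tau)$ for all $\tau\in\mathcal T_{\le p}$. Assume the following uniform flow stability: for every $R>0$ there is $L_{R,T}>0$, independent of the partition $\pi_h$, such that $|\varphi^h_{s,t}(y)-\varphi^h_{s,t}(\widetilde y)|\le L_{R,T}|y-\widetilde y|$ for all $y,\widetilde y\in B_R$ and $0\le s\le t\le T$. For a partition $\pi_h=\{0=t_0<\cdots<t_N=T\}$ with mesh $h$, let $Y^h$ be the solution of $dY^h_t=\sum_aF_a(Y^h_t)\,dZ^{h,a}_t$, $Y^h_0=Y_0$, and let $y_0^{\mathrm{SCRK}}:=Y_0$, $y_{n+1}^{\mathrm{SCRK}}:=\Psi^{\mathrm{SCRK}}_{t_n,t_{n+1}}(y_n^{\mathrm{SCRK}})$, $n=0,\dots,N-1$. Let $R>0$ be such that $y_n^{\mathrm{SCRK}}$, $\varphi^h_{t_n,t_{n+1}}(y_n^{\mathrm{SCRK}})$ and $\Psi^{\mathrm{SCRK}}_{t_n,t_{n+1}}(y_n^{\mathrm{SCRK}})$ all belong to $B_R$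 for every $n=0,\dots,N-1$. Then there exists a constant $C_{p,R,T}>0$, independent of $h$ (i.e. the same constant serves for all partitions satisfying this condition with the given $R$), such that $$\max_{0\le n\le N}|Y^h_{t_n}-y_n^{\mathrm{SCRK}}|\le C_{p,R,T}\,h^{\rho-1}.$$
   Context: Fix $\alpha\in(1/3,1/2]$, $T>0$, $m,e,q\in\mathbb N$, and an initial value $Y_0\in\mathbb R^e$. $B_R=\{y\in\mathbb R^e:|y|\le R\}$; $h=\max_n|t_{n+1}-t_n|$, $h_n=t_{n+1}-t_n$. $C_b^k$ denotes $k$ times continuously differentiable maps with all derivatives of orders $0,\dots,k$ bounded. An $\mathbf X$-controlled rough path ($\mathbf X=(X,\mathbb X)$ an $\alpha$-Hölder rough path over $\mathbb R^d$) is a pair $(Z,Z')$ of $\alpha$-Hölder paths with $Z_t-Z_s-Z'_s(X_t-X_s)=O(|t-s|^{2\alpha})$. Interpolation: $Z^h_t=Z_{t_n}+\frac{t-t_n}{h_n}(Z_{t_{n+1}}-Z_{t_n})$ for $t\in(t_n,t_{n+1}]$, $Z^h_0=Z_0$; the equation driven by $Z^h$ is, on each $(t_n,t_{n+1})$, the ODE $\frac{d}{dt}Y^h_t=\sum_aF_a(Y^h_t)\frac{Z^a_{t_{n+1}}-Z^a_{t_n}}{h_n}$. $\varphi^h_{s,t}(y)$ is the value at time $t$ of the solution of this equation started from $y$ at time $s$. Simplified controlled Runge-Kutta method: with $\Delta Z^a_{u,v}=Z^a_v-Z^a_u$ and $A=(a_{ij})$, the stages are $Y_i^{u,v}(y)=y+\sum_{a=1}^m\sum_{j=1}^qa_{ij}\Delta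 Z^a_{u,v}F_a(Y_j^{u,v}(y))$, $i=1,\dots,q$ (a solution, assumed to exist at each step when $A$ is not strictly lower triangular), and $\Psi^{\mathrm{SCRK}}_{u,v}(y)=y+\sum_{a=1}^m\sum_{i=1}^qb_i\Delta Z^a_{u,v}F_a(Y_i^{u,v}(y))$. Trees: $\mathcal T$ is the set of (nonplanar) rooted trees with vertices decorated by $\mathcal A$, $\mathbf 1$ the empty tree, $[\tau_1\cdots\tau_n]_a$ the tree obtained by joining the roots of $\tau_1,\dots,\tau_n$ to a new root decorated by $a$, $\bullet_a=[\mathbf 1]_a$, $|\tau|$ the number of vertices, $\mathcal T_{\le p}=\{\tau\in\mathcal T:|\tau|\le p\}$. Tree factorial: $\gamma(\mathbf 1)=\gamma(\bullet_a)=1$, $\gamma(\tau)=|\tau|\prod_{i=1}^k\gamma(\tau_i)$ for $\tau=[\tau_1\cdots\tau_k]_a$. With $\odot$ the componentwise product on $\mathbb R^q$ and $\mathbf 1_q=(1,\dots,1)^\top$ (the empty product): $\widehat\Phi(\mathbf 1)=\mathbf 1_q$, $\widehat\Phi([\tau_1\cdots\tau_n]_a)=A(\widehat\Phi(\tau_1)\odot\cdots\odot\widehat\Phi(\tau_n))$, $\widehat a(\mathbf 1)=1$, $\widehat a([\tau_1\cdots\tau_n]_a)=\langle b,\widehat\Phi(\tau_1)\odot\cdots\odot\widehat\Phi(\tau_n)\rangle_{\mathbb R^q}$. *)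

theory Defs
  imports "HOL-Analysis.Analysis" "HOL-Library.Multiset"
begin

section \<open>Bounded \<open>C^k\<close> maps\<close>

text \<open>\<open>iter_deriv f [v\<^sub>1, \<dots>, v\<^sub>j] x\<close> is the \<open>j\<close>-th Frechet derivative of \<open>f\<close> at \<open>x\<close>,
  evaluated at the vectors \<open>v\<^sub>1, \<dots>, v\<^sub>j\<close>.\<close>

primrec iter_deriv :: "('a::euclidean_space \<Rightarrow> 'b::euclidean_space) \<Rightarrow> 'a list \<Rightarrow> 'a \<Rightarrow> 'b" where
  "iter_deriv f [] = f"
| "iter_deriv f (v # vs) = (\<lambda>x. frechet_derivative (iter_deriv f vs) (at x) v)"

text \<open>In finite dimension, differentiability and continuity of the multilinear-map-valued derivative
  \<open>x \<mapsto> D\<^sup>j f(x)\<close> are equivalent to the same properties of all its evaluations on fixed vectors. The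
  last conjunct bounds the multilinear operator norm of \<open>D\<^sup>j f(x)\<close> uniformly in \<open>x\<close>.\<close>

definition Cb :: "nat \<Rightarrow> ('a::euclidean_space \<Rightarrow> 'b::euclidean_space) \<Rightarrow> bool" where
  "Cb k f \<longleftrightarrow>
     (\<forall>vs x. length vs < k \<longrightarrow> iter_deriv f vs differentiable (at x)) \<and>
     (\<forall>vs. length vs = k \<longrightarrow> continuous_on UNIV (iter_deriv f vs)) \<and>
     (\<forall>j\<le>k. \<exists>M. \<forall>vs x. length vs = j \<longrightarrow> norm (iter_deriv f vs x) \<le> M * prod_list (map norm vs))"


section \<open>Rough paths and controlled rough paths\<close>

definition hoelder_on :: "real \<Rightarrow> real set \<Rightarrow> (real \<Rightarrow> 'a::real_normed_vector) \<Rightarrow> bool" where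
  "hoelder_on \<alpha> S f \<longleftrightarrow> (\<exists>C. \<forall>s\<in>S. \<forall>t\<in>S. norm (f t - f s) \<le> C * \<bar>t - s\<bar> powr \<alpha>)"

text \<open>The second conjunct is Chen's relation. No geometricity is required.\<close>

definition rough_path ::
  "real \<Rightarrow> real \<Rightarrow> (real \<Rightarrow> real^'d) \<Rightarrow> (real \<Rightarrow> real \<Rightarrow> real^'d^'d) \<Rightarrow> bool" where
  "rough_path \<alpha> T X XX \<longleftrightarrow>
     hoelder_on \<alpha> {0..T} X \<and>
     (\<forall>s\<in>{0..T}. \<forall>u\<in>{0..T}. \<forall>t\<in>{0..T}.
        XX s t - XX s u - XX u t = (\<chi> i j. (X u - X s) $ i * (X t - X u) $ j)) \<and>
     (\<exists>C. \<forall>s\<in>{0..T}. \<forall>t\<in>{0..T}. norm (XX s t) \<le> C * \<bar>t - s\<bar> powr (2 * \<alpha>))"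

definition controlled_path ::
  "real \<Rightarrow> real \<Rightarrow> (real \<Rightarrow> real^'d) \<Rightarrow> (real \<Rightarrow> real^'m) \<Rightarrow> (real \<Rightarrow> real^'d^'m) \<Rightarrow> bool" where
  "controlled_path \<alpha> T X Z Z' \<longleftrightarrow>
     hoelder_on \<alpha> {0..T} Z \<and> hoelder_on \<alpha> {0..T} Z' \<and>
     (\<exists>C. \<forall>s\<in>{0..T}. \<forall>t\<in>{0..T}.
        norm (Z t - Z s - Z' s *v (X t - X s)) \<le> C * \<bar>t - s\<bar> powr (2 * \<alpha>))"


section \<open>Partitions and the equation driven by the interpolated path\<close>

definition time_partition :: "real \<Rightarrow> nat \<Rightarrow> (nat \<Rightarrow> real) \<Rightarrow> bool" where
  "time_partition T N t \<longleftrightarrow> t 0 = 0 \<and> t N = T \<and> (\<forall>n<N. t n < t (Suc n))"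

definition mesh :: "nat \<Rightarrow> (nat \<Rightarrow> real) \<Rightarrow> real" where
  "mesh N t = Max ((\<lambda>n. t (Suc n) - t n) ` {..<N})"

text \<open>\<open>Y\<close> solves on \<open>[r,s]\<close> the equation driven by the piecewise linear interpolation of \<open>Z\<close> along
  the partition: \<open>Y\<close> is continuous, and satisfies the ODE inside each cell, where the interpolation
  has slope \<open>(Z(t\<^sub>n\<^sub>+\<^sub>1) - Z(t\<^sub>n)) / (t\<^sub>n\<^sub>+\<^sub>1 - t\<^sub>n)\<close>.\<close>

definition interp_solution ::
  "('m::finite \<Rightarrow> real^'e \<Rightarrow> real^'e) \<Rightarrow> (real \<Rightarrow> real^'m) \<Rightarrow> nat \<Rightarrow> (nat \<Rightarrow> real)
     \<Rightarrow> real \<Rightarrow> real \<Rightarrow> (real \<Rightarrow> real^'e) \<Rightarrow> bool" where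
  "interp_solution F Z N t r s Y \<longleftrightarrow>
     continuous_on {r..s} Y \<and>
     (\<forall>n<N. \<forall>u \<in> {t n<..<t (Suc n)} \<inter> {r<..<s}.
        (Y has_vector_derivative
          (\<Sum>a\<in>UNIV. ((Z (t (Suc n)) $ a - Z (t n) $ a) / (t (Suc n) - t n)) *\<^sub>R F a (Y u))) (at u))"

definition interp_flow ::
  "('m::finite \<Rightarrow> real^'e \<Rightarrow> real^'e) \<Rightarrow> (real \<Rightarrow> real^'m) \<Rightarrow> nat \<Rightarrow> (nat \<Rightarrow> real)
     \<Rightarrow> real \<Rightarrow> real \<Rightarrow> real^'e \<Rightarrow> real^'e" where
  "interp_flow F Z N t r s y = (THE z. \<exists>Y. interp_solution F Z N t r s Y \<and> Y r = y \<and> Y s = z)"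


section \<open>The simplified controlled Runge-Kutta method\<close>

definition scrk_stages ::
  "real^'q^'q \<Rightarrow> ('m::finite \<Rightarrow> real^'e \<Rightarrow> real^'e) \<Rightarrow> (real \<Rightarrow> real^'m)
     \<Rightarrow> real \<Rightarrow> real \<Rightarrow> real^'e \<Rightarrow> real^'e^'q \<Rightarrow> bool" where
  "scrk_stages A F Z u v y k \<longleftrightarrow>
     (\<forall>i. k $ i = y + (\<Sum>a\<in>UNIV. \<Sum>j\<in>UNIV. (A $ i $ j * (Z v $ a - Z u $ a)) *\<^sub>R F a (k $ j)))"

text \<open>Stage systems of implicit tableaux may have several solutions. The map \<open>K\<close> selects the stages
  \<open>(Y\<^sub>i(y))\<^sub>i = K u v y\<close> used by the scheme on the step from \<open>u\<close> to \<open>v\<close>.\<close>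

definition scrk_step ::
  "real^'q \<Rightarrow> ('m::finite \<Rightarrow> real^'e \<Rightarrow> real^'e) \<Rightarrow> (real \<Rightarrow> real^'m)
     \<Rightarrow> (real \<Rightarrow> real \<Rightarrow> real^'e \<Rightarrow> real^'e^'q) \<Rightarrow> real \<Rightarrow> real \<Rightarrow> real^'e \<Rightarrow> real^'e" where
  "scrk_step b F Z K u v y =
     y + (\<Sum>a\<in>UNIV. \<Sum>i\<in>UNIV. (b $ i * (Z v $ a - Z u $ a)) *\<^sub>R F a (K u v y $ i))"

primrec scrk_iterate ::
  "real^'q \<Rightarrow> ('m::finite \<Rightarrow> real^'e \<Rightarrow> real^'e) \<Rightarrow> (real \<Rightarrow> real^'m)
     \<Rightarrow> (real \<Rightarrow> real \<Rightarrow> real^'e \<Rightarrow> real^'e^'q) \<Rightarrow> (nat \<Rightarrow> real) \<Rightarrow> real^'e \<Rightarrow> nat \<Rightarrow> real^'e" where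
  "scrk_iterate b F Z K t y0 0 = y0"
| "scrk_iterate b F Z K t y0 (Suc n) =
     scrk_step b F Z K (t n) (t (Suc n)) (scrk_iterate b F Z K t y0 n)"


section \<open>Decorated trees and tree coefficients\<close>

text \<open>Nonempty nonplanar trees: \<open>Node a {#\<tau>\<^sub>1, \<dots>, \<tau>\<^sub>n#}\<close> is \<open>[\<tau>\<^sub>1 \<cdots> \<tau>\<^sub>n]\<^sub>a\<close>, and the single vertex
  \<open>[\<one>]\<^sub>a\<close> is \<open>Node a {#}\<close>. In \<open>'a dtree\<close>, \<open>None\<close> is the empty tree \<open>\<one>\<close>.\<close>

datatype 'a rtree = Node 'a "'a rtree multiset"

type_synonym 'a dtree = "'a rtree option"

primrec rtree_order :: "'a rtree \<Rightarrow> nat" where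
  "rtree_order (Node a ts) = 1 + sum_mset (image_mset rtree_order ts)"

primrec rtree_fact :: "'a rtree \<Rightarrow> nat" where
  "rtree_fact (Node a ts) = rtree_order (Node a ts) * prod_mset (image_mset rtree_fact ts)"

text \<open>Multiplication on \<open>real^'q\<close> is componentwise, and its unit is the vector of ones.\<close>

primrec rtree_Phi :: "real^'q^'q \<Rightarrow> 'a rtree \<Rightarrow> real^'q" where
  "rtree_Phi A (Node a ts) = A *v prod_mset (image_mset (rtree_Phi A) ts)"

fun tree_order :: "'a dtree \<Rightarrow> nat" where
  "tree_order None = 0"
| "tree_order (Some \<tau>) = rtree_order \<tau>"

fun tree_fact :: "'a dtree \<Rightarrow> nat" where
  "tree_fact None = 1"
| "tree_fact (Some \<tau>) = rtree_fact \<tau>"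

fun tree_coeff :: "real^'q^'q \<Rightarrow> real^'q \<Rightarrow> 'a dtree \<Rightarrow> real" where
  "tree_coeff A b None = 1"
| "tree_coeff A b (Some (Node a ts)) = b \<bullet> prod_mset (image_mset (rtree_Phi A) ts)"

end

theory Submission
  imports Defs
begin

text \<open>The error at a grid point is a sum of local errors, each transported by the flow of the interpolated
  equation; flow stability bounds the transport by a factor \<open>L\<close>. This is \<open>global_error_telescope\<close>. It
  needs solutions of the interpolated equation to exist from every numerical value on, and to be
  unique, which holds because the vector fields are Lipschitz (\<open>Lipschitz_ode_exists\<close>,
  \<open>Lipschitz_ode_unique\<close>).

  On one cell the interpolated equation, rescaled to unit time, is \<open>x' = G x\<close> with
  \<open>G = (\<Sum>a. \<Delta>Z\<^sup>a F\<^sub>a)\<close>, and the method is one Runge-Kutta step of length \<open>1\<close> for the same field \<open>G\<close>. All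
  derivatives of \<open>G\<close> are bounded by a constant \<open>M\<close> proportional to \<open>|\<Delta>Z|\<close>, hence of order \<open>h\<^sub>n\<^sup>\<alpha>\<close>. By
  \<open>runge_kutta_local_error\<close> the local error is at most \<open>C M\<^sup>p\<^sup>+\<^sup>1\<close> with \<open>C\<close> depending only on \<open>p\<close> and the
  tableau, that is, of order \<open>h\<^sub>n\<^sup>\<rho>\<close>, and the sum of these errors is of order \<open>T h\<^sup>\<rho>\<^sup>-\<^sup>1\<close> (\<open>sum_step_powr_le\<close>).

  The local error estimate is Butcher's theory for a single vector field. The stages and the exact
  solution solve the same fixed-point equation \<open>k = y + J (G \<circ> k)\<close> with different linear operators \<open>J\<close>.
  Iterating it with Taylor's formula expands both in elementary differentials of \<open>G\<close>, indexed by trees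
  (\<open>tree_expansion\<close>); only the scalar weights of the trees depend on \<open>J\<close>. They are \<open>1 / \<gamma>(\<tau>)\<close> for the
  exact solution and the coefficients of the method for the Runge-Kutta step, so the order conditions
  cancel all trees with at most \<open>p\<close> vertices. Every vertex carries a factor \<open>M\<close>, so the other trees are of
  order \<open>M\<^sup>p\<^sup>+\<^sup>1\<close>.\<close>

section \<open>Bounded derivatives and Taylor expansion\<close>

text \<open>The quantitative form of \<open>Cb\<close> that the error analysis needs: one constant \<open>M\<close> controls all
  derivatives. On a cell the vector field is a combination of the \<open>F a\<close> with coefficients of the size
  of the increments of the driving path, so \<open>M\<close> is then small, and powers of \<open>M\<close> measure the order
  of an error term.\<close>

definition deriv_bound :: "nat \<Rightarrow> real \<Rightarrow> ('a::euclidean_space \<Rightarrow> 'b::euclidean_space) \<Rightarrow> bool" where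
  "deriv_bound n M G \<longleftrightarrow>
     (\<forall>vs x. length vs < n \<longrightarrow> iter_deriv G vs differentiable (at x)) \<and>
     (\<forall>vs x. length vs \<le> n \<longrightarrow> norm (iter_deriv G vs x) \<le> M * prod_list (map norm vs))"

lemma deriv_boundD:
  assumes "deriv_bound n M G"
  shows "length vs < n \<Longrightarrow> iter_deriv G vs differentiable (at x)"
    and "length vs \<le> n \<Longrightarrow> norm (iter_deriv G vs x) \<le> M * prod_list (map norm vs)"
  using assms unfolding deriv_bound_def by auto

lemma deriv_bound_le: "deriv_bound n M G \<Longrightarrow> k \<le> n \<Longrightarrow> deriv_bound k M G"
  unfolding deriv_bound_def by auto

lemma iter_deriv_Cons_has_derivative:
  assumes "iter_deriv G vs differentiable (at x)"
  shows "(iter_deriv G vs has_derivative (\<lambda>v. iter_deriv G (v # vs) x)) (at x)"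
  using assms by (simp add: frechet_derivative_works[symmetric])

lemma iter_deriv_linear_combination:
  fixes F :: "'i \<Rightarrow> 'a::euclidean_space \<Rightarrow> 'b::euclidean_space"
  assumes "\<And>i. i \<in> I \<Longrightarrow> deriv_bound n M (F i)" and "length vs \<le> n"
  shows "iter_deriv (\<lambda>x. \<Sum>i\<in>I. w i *\<^sub>R F i x) vs = (\<lambda>x. \<Sum>i\<in>I. w i *\<^sub>R iter_deriv (F i) vs x)"
  using assms(2)
proof (induction vs)
  case Nil
  then show ?case by simp
next
  case (Cons v vs)
  have eq: "iter_deriv (\<lambda>x. \<Sum>i\<in>I. w i *\<^sub>R F i x) vs = (\<lambda>x. \<Sum>i\<in>I. w i *\<^sub>R iter_deriv (F i) vs x)"
    using Cons by simp
  show ?case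
  proof
    fix x
    have "((\<lambda>x. \<Sum>i\<in>I. w i *\<^sub>R iter_deriv (F i) vs x) has_derivative
        (\<lambda>v. \<Sum>i\<in>I. w i *\<^sub>R iter_deriv (F i) (v # vs) x)) (at x)"
      using Cons.prems
      by (intro has_derivative_sum has_derivative_scaleR_right iter_deriv_Cons_has_derivative
          deriv_boundD(1)[OF assms(1)]) auto
    from frechet_derivative_at[OF this]
    show "iter_deriv (\<lambda>x. \<Sum>i\<in>I. w i *\<^sub>R F i x) (v # vs) x
        = (\<Sum>i\<in>I. w i *\<^sub>R iter_deriv (F i) (v # vs) x)"
      unfolding iter_deriv.simps(2)[of "\<lambda>x. \<Sum>i\<in>I. w i *\<^sub>R F i x"] eq
      by (rule fun_cong[OF sym])
  qed
qed

lemma deriv_bound_linear_combination: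
  fixes F :: "'i \<Rightarrow> 'a::euclidean_space \<Rightarrow> 'b::euclidean_space"
  assumes F: "\<And>i. i \<in> I \<Longrightarrow> deriv_bound n M (F i)"
  shows "deriv_bound n (M * (\<Sum>i\<in>I. \<bar>w i\<bar>)) (\<lambda>x. \<Sum>i\<in>I. w i *\<^sub>R F i x)"
  unfolding deriv_bound_def
proof (intro conjI allI impI)
  fix vs :: "'a list" and x
  assume len: "length vs < n"
  then have eq: "iter_deriv (\<lambda>x. \<Sum>i\<in>I. w i *\<^sub>R F i x) vs = (\<lambda>x. \<Sum>i\<in>I. w i *\<^sub>R iter_deriv (F i) vs x)"
    by (intro iter_deriv_linear_combination[OF F]) auto
  have "((\<lambda>x. \<Sum>i\<in>I. w i *\<^sub>R iter_deriv (F i) vs x) has_derivative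
        (\<lambda>v. \<Sum>i\<in>I. w i *\<^sub>R iter_deriv (F i) (v # vs) x)) (at x)"
    using len
    by (intro has_derivative_sum has_derivative_scaleR_right iter_deriv_Cons_has_derivative
        deriv_boundD(1)[OF F]) auto
  then show "iter_deriv (\<lambda>x. \<Sum>i\<in>I. w i *\<^sub>R F i x) vs differentiable at x"
    unfolding eq by (rule differentiableI)
next
  fix vs :: "'a list" and x
  assume len: "length vs \<le> n"
  have "norm (\<Sum>i\<in>I. w i *\<^sub>R iter_deriv (F i) vs x) \<le> (\<Sum>i\<in>I. \<bar>w i\<bar> * (M * prod_list (map norm vs)))"
    by (rule sum_norm_le) (auto intro!: mult_left_mono deriv_boundD(2)[OF F] len)
  also have "\<dots> = M * (\<Sum>i\<in>I. \<bar>w i\<bar>) * prod_list (map norm vs)"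
    by (simp add: sum_distrib_right sum_distrib_left mult_ac)
  finally show "norm (iter_deriv (\<lambda>x. \<Sum>i\<in>I. w i *\<^sub>R F i x) vs x)
      \<le> M * (\<Sum>i\<in>I. \<bar>w i\<bar>) * prod_list (map norm vs)"
    by (subst iter_deriv_linear_combination[OF F len]) auto
qed

text \<open>The multinomial expansion of \<open>D\<^sup>l G\<close> on the diagonal, indexed by lists rather than by
  multisets, so that no multinomial coefficients occur. Linearity in the first slot is enough: the
  induction hypothesis holds for every base point, so it can be differentiated once more in the
  direction of the combination, which adds a new first slot.\<close>

lemma iter_deriv_replicate_linear_combination:
  assumes G: "deriv_bound n M G" and "finite S" and "l \<le> n"
  shows "iter_deriv G (replicate l (\<Sum>\<tau>\<in>S. c \<tau> *\<^sub>R v \<tau>)) x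
    = (\<Sum>ts\<in>{ts. set ts \<subseteq> S \<and> length ts = l}. prod_list (map c ts) *\<^sub>R iter_deriv G (map v ts) x)"
  using assms(3)
proof (induction l arbitrary: x)
  case 0
  have "{ts. set ts \<subseteq> S \<and> length ts = 0} = {[]}" by auto
  then show ?case by simp
next
  case (Suc l)
  let ?u = "\<Sum>\<tau>\<in>S. c \<tau> *\<^sub>R v \<tau>"
  let ?L = "\<lambda>l. {ts. set ts \<subseteq> S \<and> length ts = l}"
  have IH: "iter_deriv G (replicate l ?u)
      = (\<lambda>x. \<Sum>ts\<in>?L l. prod_list (map c ts) *\<^sub>R iter_deriv G (map v ts) x)"
    using Suc by auto
  have D: "(iter_deriv G (map v ts) has_derivative (\<lambda>h. iter_deriv G (h # map v ts) x)) (at x)"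
    if "ts \<in> ?L l" for ts
    using Suc.prems that by (intro iter_deriv_Cons_has_derivative deriv_boundD(1)[OF G]) auto
  have "((\<lambda>x. \<Sum>ts\<in>?L l. prod_list (map c ts) *\<^sub>R iter_deriv G (map v ts) x) has_derivative
      (\<lambda>h. \<Sum>ts\<in>?L l. prod_list (map c ts) *\<^sub>R iter_deriv G (h # map v ts) x)) (at x)"
    by (intro has_derivative_sum has_derivative_scaleR_right D)
  from frechet_derivative_at[OF this]
  have "iter_deriv G (replicate (Suc l) ?u) x
      = (\<Sum>ts\<in>?L l. prod_list (map c ts) *\<^sub>R iter_deriv G (?u # map v ts) x)"
    unfolding replicate_Suc iter_deriv.simps(2)[of G ?u "replicate l ?u"] IH
    by (rule fun_cong[OF sym])
  also have "\<dots> = (\<Sum>ts\<in>?L l. \<Sum>\<tau>\<in>S. prod_list (map c (\<tau> # ts)) *\<^sub>R iter_deriv G (map v (\<tau> # ts)) x)"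
  proof (rule sum.cong[OF refl])
    fix ts assume ts: "ts \<in> ?L l"
    interpret lin: linear "\<lambda>h. iter_deriv G (h # map v ts) x"
      using D[OF ts] by (rule has_derivative_linear)
    show "prod_list (map c ts) *\<^sub>R iter_deriv G (?u # map v ts) x
        = (\<Sum>\<tau>\<in>S. prod_list (map c (\<tau> # ts)) *\<^sub>R iter_deriv G (map v (\<tau> # ts)) x)"
      unfolding lin.sum lin.scaleR by (simp add: scaleR_sum_right mult.commute)
  qed
  also have "\<dots> = (\<Sum>(ts, \<tau>)\<in>?L l \<times> S. prod_list (map c (\<tau> # ts)) *\<^sub>R iter_deriv G (map v (\<tau> # ts)) x)"
    by (simp add: sum.cartesian_product)
  also have "\<dots> = (\<Sum>ts\<in>?L (Suc l). prod_list (map c ts) *\<^sub>R iter_deriv G (map v ts) x)"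
    unfolding lists_length_Suc_eq
    by (subst sum.reindex) (auto simp: inj_on_def case_prod_beta)
  finally show ?case .
qed

text \<open>Taylor's formula with integral remainder along the segment from \<open>y\<close> to \<open>y + u\<close>.\<close>

lemma Taylor_iter_deriv:
  assumes G: "deriv_bound (Suc n) M G"
  shows "norm (G (y + u) - (\<Sum>l\<le>n. (1 / fact l) *\<^sub>R iter_deriv G (replicate l u) y)) \<le> M * norm u ^ Suc n"
proof -
  define Df where "Df l s = iter_deriv G (replicate l u) (y + s *\<^sub>R u)" for l :: nat and s :: real
  have Df: "(Df l has_vector_derivative Df (Suc l) s) (at s within {0..1})" if "l < Suc n" for l s
  proof -
    have "(iter_deriv G (replicate l u) has_derivative (\<lambda>v. iter_deriv G (v # replicate l u) (y + s *\<^sub>R u)))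
        (at (y + s *\<^sub>R u))"
      by (rule iter_deriv_Cons_has_derivative[OF deriv_boundD(1)[OF G]]) (use that in simp)
    moreover have "((\<lambda>s. y + s *\<^sub>R u) has_vector_derivative u) (at s within {0..1})"
      by (auto intro!: derivative_eq_intros)
    ultimately have "((iter_deriv G (replicate l u) \<circ> (\<lambda>s. y + s *\<^sub>R u)) has_vector_derivative
        iter_deriv G (u # replicate l u) (y + s *\<^sub>R u)) (at s within {0..1})"
      by (intro vector_derivative_diff_chain_within) (auto intro: has_derivative_at_withinI)
    then show ?thesis
      unfolding Df_def[abs_def] o_def by simp
  qed
  have I: "((\<lambda>x. ((1 - x) ^ (Suc n - 1) / fact (Suc n - 1)) *\<^sub>R Df (Suc n) x) has_integral
      Df 0 1 - (\<Sum>i<Suc n. ((1 - 0) ^ i / fact i) *\<^sub>R Df i 0)) (cbox 0 1)"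
    unfolding cbox_interval by (rule Taylor_has_integral) (auto intro: Df)
  have M: "0 \<le> M" using deriv_boundD(2)[OF G, of "[]" y] by (simp add: order_trans[OF norm_ge_zero])
  have "norm (Df 0 1 - (\<Sum>i<Suc n. ((1 - 0) ^ i / fact i) *\<^sub>R Df i 0)) \<le> M * norm u ^ Suc n * measure lborel (cbox 0 1 :: real set)"
  proof (rule has_integral_bound[OF _ I])
    show "0 \<le> M * norm u ^ Suc n" using M by simp
    fix x :: real assume x: "x \<in> cbox 0 1"
    have "norm (Df (Suc n) x) \<le> M * norm u ^ Suc n"
      unfolding Df_def using deriv_boundD(2)[OF G, of "replicate (Suc n) u" "y + x *\<^sub>R u"]
      by (simp add: map_replicate_const prod_list_replicate)
    moreover have "\<bar>(1 - x) ^ n / fact n\<bar> \<le> 1"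
      using x fact_ge_1[of n, where 'a=real]
      by (auto simp: divide_le_eq power_le_one intro: order_trans[of _ 1])
    ultimately show "norm (((1 - x) ^ (Suc n - 1) / fact (Suc n - 1)) *\<^sub>R Df (Suc n) x) \<le> M * norm u ^ Suc n"
      using mult_mono[of "\<bar>(1 - x) ^ n / fact n\<bar>" 1 "norm (Df (Suc n) x)" "M * norm u ^ Suc n"] by simp
  qed
  then show ?thesis
    by (simp add: Df_def lessThan_Suc_atMost)
qed

lemma deriv_bound_Lipschitz:
  assumes "deriv_bound (Suc n) M G"
  shows "norm (G x - G y) \<le> M * norm (x - y)"
  using Taylor_iter_deriv[OF deriv_bound_le[OF assms, of "Suc 0"], of y "x - y"] by simp

section \<open>Expansions indexed by planar trees\<close>

text \<open>The expansion is indexed by \<^emph>\<open>planar\<close> trees, whose children form a list: summing over all orderings of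
  the children replaces the symmetry factors of Butcher series by \<open>1 / l!\<close> at each vertex with \<open>l\<close>
  children. The vertices carry no decorations, because on one cell there is a single vector field.\<close>

datatype ptree = PNode "ptree list"

primrec porder :: "ptree \<Rightarrow> nat" where
  "porder (PNode ts) = Suc (sum_list (map porder ts))"

primrec elementary_differential ::
  "('a::euclidean_space \<Rightarrow> 'a) \<Rightarrow> 'a \<Rightarrow> ptree \<Rightarrow> 'a" where
  "elementary_differential G y (PNode ts) =
     (1 / fact (length ts)) *\<^sub>R iter_deriv G (map (elementary_differential G y) ts) y"

text \<open>The trees produced by \<open>n\<close> rounds of substituting the expansion found so far into a Taylor polynomial
  of the vector field; the last round uses degree \<open>n - 1\<close>, which bounds the number of children. Trees
  with more than \<open>n\<close> vertices can occur; they are of higher order and are estimated instead of being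
  cut off.\<close>

primrec planar_trees :: "nat \<Rightarrow> ptree set" where
  "planar_trees 0 = {}"
| "planar_trees (Suc n) = PNode ` {ts. set ts \<subseteq> planar_trees n \<and> length ts \<le> n}"

lemma finite_planar_trees: "finite (planar_trees n)"
  by (induction n) (auto intro: finite_lists_length_le)

lemma porder_pos: "0 < porder \<tau>"
  by (cases \<tau>) simp

lemma prod_list_power: "prod_list (map (\<lambda>x. a ^ f x) xs) = (a :: 'a::comm_monoid_mult) ^ sum_list (map f xs)"
  by (induction xs) (auto simp: power_add)

lemma prod_list_mono_map:
  fixes f g :: "'b \<Rightarrow> real"
  assumes "\<And>x. x \<in> set xs \<Longrightarrow> 0 \<le> f x \<and> f x \<le> g x"
  shows "0 \<le> prod_list (map f xs) \<and> prod_list (map f xs) \<le> prod_list (map g xs)"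
  using assms by (induction xs) (auto intro!: mult_mono intro: order_trans)

text \<open>Each vertex contributes one derivative of \<open>G\<close>, hence one factor \<open>M\<close>. A tree of \<open>planar_trees n\<close>
  has fewer than \<open>n\<close> children at each vertex, so derivatives up to order \<open>n - 1\<close> are enough.\<close>

lemma norm_elementary_differential_le:
  assumes G: "deriv_bound m M G" and "0 \<le> M" and "n \<le> Suc m" and "\<tau> \<in> planar_trees n"
  shows "norm (elementary_differential G y \<tau>) \<le> M ^ porder \<tau>"
  using assms(3,4)
proof (induction n arbitrary: \<tau>)
  case 0
  then show ?case by simp
next
  case (Suc n)
  then obtain ts where ts: "\<tau> = PNode ts" "set ts \<subseteq> planar_trees n" "length ts \<le> n" by auto
  let ?e = "elementary_differential G y"
  have "norm (?e \<tau>) = (1 / fact (length ts)) * norm (iter_deriv G (map ?e ts) y)"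
    by (simp add: ts)
  also have "\<dots> \<le> 1 * (M * prod_list (map norm (map ?e ts)))"
    using Suc.prems ts
    by (intro mult_mono deriv_boundD(2)[OF G]) (auto simp: divide_le_eq fact_ge_1)
  also have "\<dots> \<le> M * prod_list (map (\<lambda>\<sigma>. M ^ porder \<sigma>) ts)"
  proof -
    have "prod_list (map (norm \<circ> ?e) ts) \<le> prod_list (map (\<lambda>\<sigma>. M ^ porder \<sigma>) ts)"
      using prod_list_mono_map[of ts "norm \<circ> ?e" "\<lambda>\<sigma>. M ^ porder \<sigma>"] Suc ts by auto
    then show ?thesis using \<open>0 \<le> M\<close> by (auto intro: mult_left_mono)
  qed
  also have "\<dots> = M ^ porder \<tau>"
    by (simp add: ts prod_list_power)
  finally show ?case .
qed

text \<open>Runge-Kutta stages and exact solutions both satisfy \<open>k = y + J (G \<circ> k)\<close> for a linear operator \<open>J\<close>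
  on functions of an index \<open>i\<close> (a stage number or a time): a matrix in one case, integration from \<open>0\<close>
  in the other. The expansion in trees depends on nothing else, so it is proved once here. \<open>J\<close> is a
  relation between argument and value, because integration is defined only for integrable functions.
  The weights \<open>\<Phi>\<close> are tied to \<open>J\<close> by Butcher's recursion: apply \<open>J\<close> to the product of the weights of
  the children.\<close>

locale stage_operator =
  fixes I :: "'i set"
    and J :: "('i \<Rightarrow> 'v::euclidean_space) \<Rightarrow> ('i \<Rightarrow> 'v) \<Rightarrow> bool"
    and K :: real
    and \<Phi> :: "ptree \<Rightarrow> 'i \<Rightarrow> real"
  assumes K_nonneg: "0 \<le> K"
    and J_zero: "J (\<lambda>i. 0) (\<lambda>i. 0)"
    and J_add: "J f g \<Longrightarrow> J f' g' \<Longrightarrow> J (\<lambda>i. f i + f' i) (\<lambda>i. g i + g' i)"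
    and J_diff: "J f g \<Longrightarrow> J f' g' \<Longrightarrow> J (\<lambda>i. f i - f' i) (\<lambda>i. g i - g' i)"
    and J_bound: "J f g \<Longrightarrow> (\<And>i. i \<in> I \<Longrightarrow> norm (f i) \<le> c) \<Longrightarrow> i \<in> I \<Longrightarrow> norm (g i) \<le> K * c"
    and J_weight: "J (\<lambda>i. prod_list (map (\<lambda>\<sigma>. \<Phi> \<sigma> i) ts) *\<^sub>R v) (\<lambda>i. \<Phi> (PNode ts) i *\<^sub>R v)"
    and weight_bounded: "\<exists>W. \<forall>i\<in>I. \<bar>\<Phi> \<tau> i\<bar> \<le> W"
begin

lemma J_sum:
  assumes "finite S" and "\<And>s. s \<in> S \<Longrightarrow> J (f s) (g s)"
  shows "J (\<lambda>i. \<Sum>s\<in>S. f s i) (\<lambda>i. \<Sum>s\<in>S. g s i)"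
  using assms by (induction S rule: finite_induct) (auto intro: J_zero J_add)

text \<open>One more round of the fixed-point equation \<open>k = y + J (G \<circ> k)\<close> improves the order by one. If \<open>s\<close> is
  the partial expansion of \<open>k - y\<close>, then \<open>G (k i)\<close> differs from \<open>G (y + s i)\<close> by \<open>M\<close> times the old
  error, by the Lipschitz bound, and \<open>G (y + s i)\<close> is its Taylor polynomial up to \<open>M (B M)\<^sup>n\<^sup>+\<^sup>1\<close>. The
  multinomial expansion turns this polynomial into the sum over trees whose children were present in
  the previous round, and \<open>J\<close> turns products of weights into weights. The constant depends only on
  the operator and its weights, not on \<open>G\<close>, \<open>y\<close>, \<open>M\<close> or \<open>k\<close>; this gives one constant for all cells of all
  partitions.\<close>

lemma tree_expansion:
  "\<exists>C\<ge>0. \<forall>G M y k. deriv_bound n M G \<longrightarrow> 0 \<le> M \<longrightarrow> M \<le> 1 \<longrightarrow> J (\<lambda>i. G (k i)) (\<lambda>i. k i - y) \<longrightarrow>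
     (\<forall>i\<in>I. norm (k i - y - (\<Sum>\<tau>\<in>planar_trees n. \<Phi> \<tau> i *\<^sub>R elementary_differential G y \<tau>))
        \<le> C * M ^ Suc n)"
proof (induction n)
  case 0
  show ?case
  proof (intro exI[of _ K] conjI allI impI ballI K_nonneg)
    fix G M y k i
    assume G: "deriv_bound 0 M G" and J: "J (\<lambda>i. G (k i)) (\<lambda>i. k i - y)" and i: "i \<in> I"
    have "norm (k i - y) \<le> K * M"
      by (rule J_bound[OF J _ i]) (use deriv_boundD(2)[OF G, of "[]"] in auto)
    then show "norm (k i - y - (\<Sum>\<tau>\<in>planar_trees 0. \<Phi> \<tau> i *\<^sub>R elementary_differential G y \<tau>)) \<le> K * M ^ Suc 0"
      by simp
  qed
next
  case (Suc n)
  let ?T = "planar_trees n" and ?L = "{ts. set ts \<subseteq> planar_trees n \<and> length ts \<le> n}"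
  from Suc obtain C where C: "0 \<le> C" and expansion:
    "\<And>G M y k i. deriv_bound n M G \<Longrightarrow> 0 \<le> M \<Longrightarrow> M \<le> 1 \<Longrightarrow> J (\<lambda>i. G (k i)) (\<lambda>i. k i - y) \<Longrightarrow> i \<in> I \<Longrightarrow>
       norm (k i - y - (\<Sum>\<tau>\<in>?T. \<Phi> \<tau> i *\<^sub>R elementary_differential G y \<tau>)) \<le> C * M ^ Suc n"
    by blast
  obtain W where W: "\<And>\<tau> i. i \<in> I \<Longrightarrow> \<bar>\<Phi> \<tau> i\<bar> \<le> W \<tau>"
    using weight_bounded by metis
  define B where "B = (\<Sum>\<tau>\<in>?T. \<bar>W \<tau>\<bar>)"
  have B: "0 \<le> B" by (simp add: B_def sum_nonneg)
  show ?case
  proof (intro exI[of _ "K * (C + B ^ Suc n)"] conjI allI impI ballI)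
    show "0 \<le> K * (C + B ^ Suc n)" using B C K_nonneg by simp
    fix G M y k i
    assume G: "deriv_bound (Suc n) M G" and M: "0 \<le> M" "M \<le> 1"
      and J: "J (\<lambda>i. G (k i)) (\<lambda>i. k i - y)" and i: "i \<in> I"
    let ?e = "elementary_differential G y"
    define s where "s i = (\<Sum>\<tau>\<in>?T. \<Phi> \<tau> i *\<^sub>R ?e \<tau>)" for i
    (* f is the integrand whose image under J is the sum over the trees of the next round. *)
    define f where "f \<tau> i = (case \<tau> of PNode ts \<Rightarrow> prod_list (map (\<lambda>\<sigma>. \<Phi> \<sigma> i) ts) *\<^sub>R ?e \<tau>)" for \<tau> i
    have s_le: "norm (s i) \<le> B * M" if "i \<in> I" for i
      unfolding s_def B_def sum_distrib_right
    proof (rule sum_norm_le)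
      fix \<tau> assume \<tau>: "\<tau> \<in> ?T"
      have "norm (?e \<tau>) \<le> M ^ porder \<tau>"
        by (rule norm_elementary_differential_le[OF G M(1) _ \<tau>]) simp
      also have "\<dots> \<le> M ^ 1"
        using M porder_pos[of \<tau>] by (intro power_decreasing) auto
      finally show "norm (\<Phi> \<tau> i *\<^sub>R ?e \<tau>) \<le> \<bar>W \<tau>\<bar> * M"
        using W[OF that, of \<tau>] by (auto intro!: mult_mono)
    qed
    have taylor: "(\<Sum>l\<le>n. (1 / fact l) *\<^sub>R iter_deriv G (replicate l (s i)) y) = (\<Sum>\<tau>\<in>planar_trees (Suc n). f \<tau> i)" for i
    proof -
      have fin: "finite ?L" by (rule finite_lists_length_le[OF finite_planar_trees])
      have "(\<Sum>\<tau>\<in>planar_trees (Suc n). f \<tau> i) = (\<Sum>ts\<in>?L. f (PNode ts) i)"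
        by (simp add: sum.reindex inj_on_def)
      also have "\<dots> = (\<Sum>l\<le>n. \<Sum>ts\<in>{ts \<in> ?L. length ts = l}. f (PNode ts) i)"
        by (rule sum.group[symmetric]) (use fin in auto)
      also have "\<dots> = (\<Sum>l\<le>n. (1 / fact l) *\<^sub>R iter_deriv G (replicate l (s i)) y)"
      proof (rule sum.cong[OF refl])
        fix l assume l: "l \<in> {..n}"
        have "(1 / fact l) *\<^sub>R iter_deriv G (replicate l (s i)) y
          = (1 / fact l) *\<^sub>R (\<Sum>ts\<in>{ts. set ts \<subseteq> ?T \<and> length ts = l}.
              prod_list (map (\<lambda>\<sigma>. \<Phi> \<sigma> i) ts) *\<^sub>R iter_deriv G (map ?e ts) y)"
          unfolding s_def
          by (subst iter_deriv_replicate_linear_combination[OF G finite_planar_trees]) (use l in auto)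
        also have "\<dots> = (\<Sum>ts\<in>{ts \<in> ?L. length ts = l}. f (PNode ts) i)"
          unfolding scaleR_sum_right using l by (intro sum.cong) (auto simp: f_def mult.commute)
        finally show "(\<Sum>ts\<in>{ts \<in> ?L. length ts = l}. f (PNode ts) i)
          = (1 / fact l) *\<^sub>R iter_deriv G (replicate l (s i)) y" ..
      qed
      finally show ?thesis ..
    qed
    have remainder: "norm (G (k i) - (\<Sum>\<tau>\<in>planar_trees (Suc n). f \<tau> i)) \<le> (C + B ^ Suc n) * M ^ Suc (Suc n)"
      if i: "i \<in> I" for i
    proof -
      have "norm (G (k i) - G (y + s i)) \<le> M * norm (k i - (y + s i))"
        by (rule deriv_bound_Lipschitz[OF G])
      also have "\<dots> \<le> M * (C * M ^ Suc n)"
        using expansion[OF deriv_bound_le[OF G] M J i] M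
        by (intro mult_left_mono) (auto simp: s_def diff_diff_eq)
      finally have 1: "norm (G (k i) - G (y + s i)) \<le> M * (C * M ^ Suc n)" .
      have "norm (G (y + s i) - (\<Sum>\<tau>\<in>planar_trees (Suc n). f \<tau> i)) \<le> M * norm (s i) ^ Suc n"
        using Taylor_iter_deriv[OF G, of y "s i"] unfolding taylor .
      also have "\<dots> \<le> M * (B * M) ^ Suc n"
        using s_le[OF i] M by (intro mult_left_mono power_mono) auto
      finally have 2: "norm (G (y + s i) - (\<Sum>\<tau>\<in>planar_trees (Suc n). f \<tau> i)) \<le> M * (B * M) ^ Suc n" .
      have "norm (G (k i) - (\<Sum>\<tau>\<in>planar_trees (Suc n). f \<tau> i)) \<le> M * (C * M ^ Suc n) + M * (B * M) ^ Suc n"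
        using norm_triangle_mono[OF 1 2] by (simp del: planar_trees.simps)
      also have "\<dots> = (C + B ^ Suc n) * M ^ Suc (Suc n)"
        by (simp add: algebra_simps power_mult_distrib)
      finally show ?thesis .
    qed
    have "J (\<lambda>i. \<Sum>\<tau>\<in>planar_trees (Suc n). f \<tau> i) (\<lambda>i. \<Sum>\<tau>\<in>planar_trees (Suc n). \<Phi> \<tau> i *\<^sub>R ?e \<tau>)"
      by (intro J_sum finite_planar_trees)
         (auto simp: f_def simp del: elementary_differential.simps intro!: J_weight)
    from J_bound[OF J_diff[OF J this] remainder i]
    show "norm (k i - y - (\<Sum>\<tau>\<in>planar_trees (Suc n). \<Phi> \<tau> i *\<^sub>R ?e \<tau>)) \<le> K * (C + B ^ Suc n) * M ^ Suc (Suc n)"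
      by (simp add: mult.assoc)
  qed
qed

end

section \<open>The exact solution and Runge-Kutta steps as stage operators\<close>

primrec pfact :: "ptree \<Rightarrow> nat" where
  "pfact (PNode ts) = porder (PNode ts) * prod_list (map pfact ts)"

lemma pfact_pos: "0 < pfact \<tau>"
proof (induction \<tau>)
  case (PNode ts)
  then have "0 < prod_list (map pfact ts)" by (induction ts) auto
  then show ?case by simp
qed

lemma prod_list_divide: "prod_list (map (\<lambda>x. f x / g x) xs) = prod_list (map f xs) / (prod_list (map g xs) :: real)"
  by (induction xs) auto

lemma of_nat_prod_list: "real (prod_list xs) = prod_list (map real xs)"
  by (induction xs) auto

text \<open>For integration from \<open>0\<close> to \<open>t\<close> the recursion of the weights is solved by \<open>t\<^sup>|\<^sup>\<tau>\<^sup>| / \<gamma>(\<tau>)\<close>: the integral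
  of a product of monomials of degrees \<open>|\<tau>\<^sub>i|\<close> has the denominator \<open>|\<tau>|\<close>, the root factor of \<open>\<gamma>(\<tau>)\<close>.\<close>

interpretation exact_solution: stage_operator "{0..1::real}"
  "\<lambda>(f :: real \<Rightarrow> 'v::euclidean_space) g. \<forall>t\<in>{0..1}. (f has_integral g t) {0..t}" 1
  "\<lambda>\<tau> t. t ^ porder \<tau> / real (pfact \<tau>)"
proof
  show "\<exists>W. \<forall>t\<in>{0..1}. \<bar>t ^ porder \<tau> / real (pfact \<tau>)\<bar> \<le> W" for \<tau>
  proof (intro exI ballI)
    fix t :: real assume "t \<in> {0..1}"
    then have "t ^ porder \<tau> \<le> 1" by (auto intro: power_le_one)
    then show "\<bar>t ^ porder \<tau> / real (pfact \<tau>)\<bar> \<le> 1 / real (pfact \<tau>)"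
      using \<open>t \<in> {0..1}\<close> by (auto intro: divide_right_mono)
  qed
next
  fix f g :: "real \<Rightarrow> 'v" and c t :: real
  assume J: "\<forall>t\<in>{0..1}. (f has_integral g t) {0..t}" and c: "\<And>t. t \<in> {0..1} \<Longrightarrow> norm (f t) \<le> c" and t: "t \<in> {0..1}"
  have c0: "0 \<le> c" using order_trans[OF norm_ge_zero c[of 0]] by simp
  have I: "(f has_integral g t) (cbox 0 t)" using J t by simp
  have "norm (g t) \<le> c * measure lborel (cbox 0 t)"
    by (rule has_integral_bound[OF c0 I]) (use c t in auto)
  also have "\<dots> \<le> 1 * c" using t c0 by (simp add: mult_left_le)
  finally show "norm (g t) \<le> 1 * c" .
next
  fix ts and v :: 'v
  let ?n = "sum_list (map porder ts)" and ?c = "real (prod_list (map pfact ts))"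
  have c: "?c \<noteq> 0" using pfact_pos by (induction ts) auto
  have eq: "(\<lambda>t. prod_list (map (\<lambda>\<sigma>. t ^ porder \<sigma> / real (pfact \<sigma>)) ts) *\<^sub>R v) = (\<lambda>t. (t ^ ?n / ?c) *\<^sub>R v)"
    by (simp add: prod_list_divide prod_list_power of_nat_prod_list o_def)
  show "\<forall>t\<in>{0..1}. ((\<lambda>t. prod_list (map (\<lambda>\<sigma>. t ^ porder \<sigma> / real (pfact \<sigma>)) ts) *\<^sub>R v) has_integral
      (t ^ porder (PNode ts) / real (pfact (PNode ts))) *\<^sub>R v) {0..t}"
    unfolding eq
  proof
    fix t :: real assume t: "t \<in> {0..1}"
    have D: "((\<lambda>s. (s ^ Suc ?n / (real (Suc ?n) * ?c)) *\<^sub>R v) has_vector_derivative (s ^ ?n / ?c) *\<^sub>R v) (at s within {0..t})" for s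
    proof -
      have "((\<lambda>s. s ^ Suc ?n / (real (Suc ?n) * ?c)) has_real_derivative (real (Suc ?n) * s ^ ?n / (real (Suc ?n) * ?c))) (at s within {0..t})"
        by (rule DERIV_cdivide) (use DERIV_pow[of "Suc ?n" s] in simp)
      then have "((\<lambda>s. s ^ Suc ?n / (real (Suc ?n) * ?c)) has_real_derivative s ^ ?n / ?c) (at s within {0..t})"
        by (simp del: of_nat_Suc)
      from has_vector_derivative_scaleR[OF this has_vector_derivative_const[of v]]
      show ?thesis by simp
    qed
    have "((\<lambda>s. (s ^ ?n / ?c) *\<^sub>R v) has_integral
        (t ^ Suc ?n / (real (Suc ?n) * ?c)) *\<^sub>R v - (0 ^ Suc ?n / (real (Suc ?n) * ?c)) *\<^sub>R v) {0..t}"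
      by (rule fundamental_theorem_of_calculus) (use t D in auto)
    then show "((\<lambda>s. (s ^ ?n / ?c) *\<^sub>R v) has_integral (t ^ porder (PNode ts) / real (pfact (PNode ts))) *\<^sub>R v) {0..t}"
      by (simp add: algebra_simps)
  qed
qed (auto intro: has_integral_add has_integral_diff)

text \<open>The order conditions speak of nonplanar decorated trees. Neither the tree factorial nor the
  coefficients of the method see decorations or orderings, so a planar tree is translated by
  forgetting the order of the children and giving every vertex the same decoration \<open>a\<close>.\<close>

primrec decorate :: "'a \<Rightarrow> ptree \<Rightarrow> 'a rtree" where
  "decorate a (PNode ts) = Node a (mset (map (decorate a) ts))"

lemma rtree_order_decorate: "rtree_order (decorate a \<tau>) = porder \<tau>"
proof (induction \<tau>)
  case (PNode ts)
  then have eq: "map (rtree_order \<circ> decorate a) ts = map porder ts" by simp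
  then show ?case by (simp add: sum_mset_sum_list eq flip: mset_map)
qed

lemma rtree_fact_decorate: "rtree_fact (decorate a \<tau>) = pfact \<tau>"
proof (induction \<tau>)
  case (PNode ts)
  then have eq: "map (rtree_fact \<circ> decorate a) ts = map pfact ts" by simp
  then show ?case using rtree_order_decorate[of a "PNode ts"]
    by (simp add: prod_mset_prod_list eq flip: mset_map)
qed

text \<open>The output of the step is treated as an additional stage, with index \<open>None\<close> and row \<open>b\<close>.\<close>

definition tableau :: "real^'q^'q \<Rightarrow> real^'q \<Rightarrow> 'q option \<Rightarrow> 'q \<Rightarrow> real" where
  "tableau A b i j = (case i of None \<Rightarrow> b $ j | Some i \<Rightarrow> A $ i $ j)"

definition tableau_weight :: "real^'q^'q \<Rightarrow> real^'q \<Rightarrow> 'a \<Rightarrow> ptree \<Rightarrow> 'q option \<Rightarrow> real" where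
  "tableau_weight A b a \<tau> i =
     (case i of None \<Rightarrow> tree_coeff A b (Some (decorate a \<tau>)) | Some i \<Rightarrow> rtree_Phi A (decorate a \<tau>) $ i)"

lemma prod_list_nth: "prod_list xs $ j = prod_list (map (\<lambda>x. x $ j) xs)" for xs :: "(real^'q) list"
  by (induction xs) auto

lemma tableau_weight_PNode:
  "tableau_weight A b a (PNode ts) i
    = (\<Sum>j\<in>UNIV. tableau A b i j * prod_list (map (\<lambda>\<sigma>. tableau_weight A b a \<sigma> (Some j)) ts))"
  by (cases i) (auto simp: tableau_weight_def tableau_def prod_mset_prod_list prod_list_nth o_def
      matrix_vector_mult_def inner_vec_def simp flip: mset_map)

interpretation runge_kutta: stage_operator UNIV
  "\<lambda>(f :: 'q::finite option \<Rightarrow> 'v::euclidean_space) g. \<forall>i. g i = (\<Sum>j\<in>UNIV. tableau A b i j *\<^sub>R f (Some j))"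
  "\<Sum>i\<in>UNIV. \<Sum>j\<in>UNIV. \<bar>tableau A b i j\<bar>" "tableau_weight A b a"
  for A b a
proof
  show "\<exists>W. \<forall>i\<in>UNIV. \<bar>tableau_weight A b a \<tau> i\<bar> \<le> W" for \<tau>
    by (rule exI[of _ "Max (range (\<lambda>i. \<bar>tableau_weight A b a \<tau> i\<bar>))"]) auto
next
  fix f g :: "'q option \<Rightarrow> 'v" and c i
  assume J: "\<forall>i. g i = (\<Sum>j\<in>UNIV. tableau A b i j *\<^sub>R f (Some j))" and c: "\<And>i. i \<in> UNIV \<Longrightarrow> norm (f i) \<le> c"
  have c0: "0 \<le> c" using order_trans[OF norm_ge_zero c[of None]] by simp
  have "norm (g i) \<le> (\<Sum>j\<in>UNIV. \<bar>tableau A b i j\<bar> * c)"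
    unfolding J[rule_format, of i] by (rule sum_norm_le) (auto intro!: mult_left_mono c)
  also have "\<dots> = (\<Sum>j\<in>UNIV. \<bar>tableau A b i j\<bar>) * c" by (simp add: sum_distrib_right)
  also have "\<dots> \<le> (\<Sum>i\<in>UNIV. \<Sum>j\<in>UNIV. \<bar>tableau A b i j\<bar>) * c"
    by (intro mult_right_mono c0 member_le_sum[of i UNIV "\<lambda>i. \<Sum>j\<in>UNIV. \<bar>tableau A b i j\<bar>"]) (auto intro: sum_nonneg)
  finally show "norm (g i) \<le> (\<Sum>i\<in>UNIV. \<Sum>j\<in>UNIV. \<bar>tableau A b i j\<bar>) * c" .
qed (auto simp: tableau_weight_PNode scaleR_sum_left scaleR_right_distrib scaleR_right_diff_distrib
    sum.distrib sum_subtractf intro: sum_nonneg)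

section \<open>The local error\<close>

text \<open>The exact solution at time \<open>1\<close> and the output of the Runge-Kutta step have expansions over the same
  trees with the same elementary differentials. The order conditions cancel the trees with at most
  \<open>p\<close> vertices, and every remaining one is bounded by \<open>M\<^sup>p\<^sup>+\<^sup>1\<close> as long as \<open>M \<le> 1\<close>. For \<open>M > 1\<close> both
  results are at distance of order \<open>M\<close> from \<open>y\<close>, which is at most of order \<open>M\<^sup>p\<^sup>+\<^sup>1\<close>.\<close>

lemma runge_kutta_local_error:
  fixes A :: "real^'q^'q" and b :: "real^'q"
  assumes order: "\<And>\<tau> :: 'm dtree. tree_order \<tau> \<le> p \<Longrightarrow> tree_coeff A b \<tau> = 1 / real (tree_fact \<tau>)"
  shows "\<exists>C\<ge>0. \<forall>(G :: 'v::euclidean_space \<Rightarrow> 'v) M y k x. deriv_bound p M G \<longrightarrow>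
      (\<forall>i. k i = y + (\<Sum>j\<in>UNIV. (A $ i $ j) *\<^sub>R G (k j))) \<longrightarrow>
      continuous_on {0..1} x \<longrightarrow> (\<forall>t\<in>{0<..<1}. (x has_vector_derivative G (x t)) (at t)) \<longrightarrow> x 0 = y \<longrightarrow>
      norm (x 1 - (y + (\<Sum>i\<in>UNIV. (b $ i) *\<^sub>R G (k i)))) \<le> C * M ^ Suc p"
proof -
  obtain a :: 'm where True by simp
  let ?T = "planar_trees p" and ?w = "tableau_weight A b a" and ?e = elementary_differential
  define K where "K = (\<Sum>i\<in>UNIV. \<Sum>j\<in>UNIV. \<bar>tableau A b i j\<bar>)"
  define S where "S = (\<Sum>\<tau>\<in>?T. \<bar>1 / real (pfact \<tau>) - ?w \<tau> None\<bar>)"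
  have K: "0 \<le> K" and S: "0 \<le> S" by (auto simp: K_def S_def intro!: sum_nonneg)
  obtain C1 where C1: "0 \<le> C1"
    "\<And>(G :: 'v \<Rightarrow> 'v) M y x t. deriv_bound p M G \<Longrightarrow> 0 \<le> M \<Longrightarrow> M \<le> 1 \<Longrightarrow>
      (\<forall>t\<in>{0..1}. ((\<lambda>t. G (x t)) has_integral x t - y) {0..t}) \<Longrightarrow> t \<in> {0..1} \<Longrightarrow>
      norm (x t - y - (\<Sum>\<tau>\<in>?T. (t ^ porder \<tau> / real (pfact \<tau>)) *\<^sub>R ?e G y \<tau>)) \<le> C1 * M ^ Suc p"
    using exact_solution.tree_expansion[of p] by blast
  obtain C2 where C2: "0 \<le> C2"
    "\<And>(G :: 'v \<Rightarrow> 'v) M y k i. deriv_bound p M G \<Longrightarrow> 0 \<le> M \<Longrightarrow> M \<le> 1 \<Longrightarrow>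
      (\<forall>i. k i - y = (\<Sum>j\<in>UNIV. tableau A b i j *\<^sub>R G (k (Some j)))) \<Longrightarrow>
      norm (k i - y - (\<Sum>\<tau>\<in>?T. ?w \<tau> i *\<^sub>R ?e G y \<tau>)) \<le> C2 * M ^ Suc p"
    using runge_kutta.tree_expansion[of p A b a] by blast
  show ?thesis
  proof (intro exI[of _ "C1 + C2 + S + (1 + K)"] conjI allI impI)
    show "0 \<le> C1 + C2 + S + (1 + K)" using C1(1) C2(1) S K by simp
    fix G :: "'v \<Rightarrow> 'v" and M y k x
    assume G: "deriv_bound p M G" and k: "\<forall>i. k i = y + (\<Sum>j\<in>UNIV. (A $ i $ j) *\<^sub>R G (k j))"
      and cont: "continuous_on {0..1} x" and deriv: "\<forall>t\<in>{0<..<1}. (x has_vector_derivative G (x t)) (at t)"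
      and x0: "x 0 = y"
    define z where "z = y + (\<Sum>i\<in>UNIV. (b $ i) *\<^sub>R G (k i))"
    define k' where "k' i = (case i of None \<Rightarrow> z | Some i \<Rightarrow> k i)" for i
    have GM: "norm (G y) \<le> M" for y using deriv_boundD(2)[OF G, of "[]" y] by simp
    have M: "0 \<le> M" using order_trans[OF norm_ge_zero GM] .
    have J1: "\<forall>t\<in>{0..1}. ((\<lambda>t. G (x t)) has_integral x t - y) {0..t}"
    proof
      fix t :: real assume "t \<in> {0..1}"
      then show "((\<lambda>t. G (x t)) has_integral x t - y) {0..t}"
        unfolding x0[symmetric] using deriv
        by (intro fundamental_theorem_of_calculus_interior continuous_on_subset[OF cont]) auto
    qed
    have J2: "\<forall>i. k' i - y = (\<Sum>j\<in>UNIV. tableau A b i j *\<^sub>R G (k' (Some j)))"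
    proof
      fix i show "k' i - y = (\<Sum>j\<in>UNIV. tableau A b i j *\<^sub>R G (k' (Some j)))"
      proof (cases i)
        case None
        then show ?thesis by (simp add: k'_def tableau_def z_def)
      next
        case (Some i')
        have "k i' - y = (\<Sum>j\<in>UNIV. (A $ i' $ j) *\<^sub>R G (k j))"
          by (subst k[rule_format]) simp
        then show ?thesis by (simp add: Some k'_def tableau_def)
      qed
    qed
    have "norm (x 1 - z) \<le> (C1 + C2 + S + (1 + K)) * M ^ Suc p"
    proof (cases "M \<le> 1")
      case False
      have "norm (x 1 - y) \<le> 1 * M" by (rule exact_solution.J_bound[OF J1 GM]) simp
      moreover have "norm (k' None - y) \<le> K * M"
        using runge_kutta.J_bound[OF J2, of M None] GM by (simp add: K_def)
      ultimately have "norm (x 1 - z) \<le> M + K * M"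
        using norm_triangle_ineq4[of "x 1 - y" "z - y"] by (simp add: k'_def)
      also have "\<dots> = (1 + K) * M ^ 1" by (simp add: algebra_simps)
      also have "\<dots> \<le> (C1 + C2 + S + (1 + K)) * M ^ Suc p"
        using False K S C1(1) C2(1) by (intro mult_mono power_increasing) auto
      finally show ?thesis .
    next
      case True
      let ?s1 = "\<Sum>\<tau>\<in>?T. (1 / real (pfact \<tau>)) *\<^sub>R ?e G y \<tau>" and ?s2 = "\<Sum>\<tau>\<in>?T. ?w \<tau> None *\<^sub>R ?e G y \<tau>"
      have e1: "norm (x 1 - y - ?s1) \<le> C1 * M ^ Suc p"
        using C1(2)[OF G M True J1, of 1] by simp
      have e2: "norm (z - y - ?s2) \<le> C2 * M ^ Suc p"
        using C2(2)[OF G M True J2, of None] by (simp add: k'_def)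
      have "norm (?s1 - ?s2) = norm (\<Sum>\<tau>\<in>?T. (1 / real (pfact \<tau>) - ?w \<tau> None) *\<^sub>R ?e G y \<tau>)"
        by (simp add: sum_subtractf scaleR_left_diff_distrib)
      also have "\<dots> \<le> (\<Sum>\<tau>\<in>?T. \<bar>1 / real (pfact \<tau>) - ?w \<tau> None\<bar> * M ^ Suc p)"
      proof (rule sum_norm_le)
        fix \<tau> assume \<tau>: "\<tau> \<in> ?T"
        show "norm ((1 / real (pfact \<tau>) - ?w \<tau> None) *\<^sub>R ?e G y \<tau>) \<le> \<bar>1 / real (pfact \<tau>) - ?w \<tau> None\<bar> * M ^ Suc p"
        proof (cases "porder \<tau> \<le> p")
          case True
          then have "?w \<tau> None = 1 / real (pfact \<tau>)"
            using order[of "Some (decorate a \<tau>)"]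
            by (simp add: tableau_weight_def rtree_order_decorate rtree_fact_decorate)
          then show ?thesis by simp
        next
          case False
          have "norm (?e G y \<tau>) \<le> M ^ porder \<tau>"
            by (rule norm_elementary_differential_le[OF G M _ \<tau>]) simp
          also have "\<dots> \<le> M ^ Suc p"
            using False M \<open>M \<le> 1\<close> by (intro power_decreasing) auto
          finally show ?thesis by (auto intro: mult_left_mono)
        qed
      qed
      also have "\<dots> = S * M ^ Suc p" by (simp add: S_def sum_distrib_right)
      finally have e3: "norm (?s1 - ?s2) \<le> S * M ^ Suc p" .
      have "norm (x 1 - z) = norm ((x 1 - y - ?s1) - (z - y - ?s2) + (?s1 - ?s2))" by simp
      also have "\<dots> \<le> norm (x 1 - y - ?s1) + norm (z - y - ?s2) + norm (?s1 - ?s2)"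
        by (intro norm_triangle_mono norm_triangle_ineq4 order_refl)
      also have "\<dots> \<le> C1 * M ^ Suc p + C2 * M ^ Suc p + S * M ^ Suc p" by (intro add_mono e1 e2 e3)
      also have "\<dots> \<le> (C1 + C2 + S + (1 + K)) * M ^ Suc p"
        using K M unfolding distrib_right[symmetric] by (intro mult_right_mono) auto
      finally show ?thesis .
    qed
    then show "norm (x 1 - (y + (\<Sum>i\<in>UNIV. (b $ i) *\<^sub>R G (k i)))) \<le> (C1 + C2 + S + (1 + K)) * M ^ Suc p"
      by (simp add: z_def)
  qed
qed

section \<open>Existence and uniqueness for Lipschitz vector fields\<close>

text \<open>Gronwall's argument: \<open>exp (- 2 L t) |x t - y t|\<^sup>2\<close> is nonincreasing.\<close>

lemma Lipschitz_ode_unique: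
  fixes x y :: "real \<Rightarrow> 'v::real_inner"
  assumes L: "\<And>u v. norm (G u - G v) \<le> L * norm (u - v)" and "r \<le> s"
    and cont: "continuous_on {r..s} x" "continuous_on {r..s} y"
    and deriv: "\<And>t. t \<in> {r<..<s} \<Longrightarrow> (x has_vector_derivative G (x t)) (at t)"
      "\<And>t. t \<in> {r<..<s} \<Longrightarrow> (y has_vector_derivative G (y t)) (at t)"
    and init: "x r = y r"
  shows "x s = y s"
proof -
  define E where "E t = exp (- (2 * L * t)) * ((x t - y t) \<bullet> (x t - y t))" for t
  have "E s \<le> E r"
  proof (rule DERIV_nonpos_imp_decreasing_open[OF \<open>r \<le> s\<close>])
    show "continuous_on {r..s} E"
      unfolding E_def by (intro continuous_intros cont)
    fix t assume t: "r < t" "t < s"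
    let ?d = "x t - y t" and ?D = "G (x t) - G (y t)"
    have "((\<lambda>t. (x t - y t) \<bullet> (x t - y t)) has_derivative (\<lambda>h. ?d \<bullet> (h *\<^sub>R ?D) + (h *\<^sub>R ?D) \<bullet> ?d)) (at t)"
      using deriv[of t] t unfolding has_vector_derivative_def
      by (auto intro!: derivative_eq_intros simp: algebra_simps)
    then have I: "((\<lambda>t. (x t - y t) \<bullet> (x t - y t)) has_real_derivative 2 * (?d \<bullet> ?D)) (at t)"
      unfolding has_field_derivative_def by (rule has_derivative_eq_rhs) (auto simp: inner_commute algebra_simps)
    have "((\<lambda>t. exp (- (2 * L * t))) has_real_derivative exp (- (2 * L * t)) * - (2 * L)) (at t)"
      by (auto intro!: derivative_eq_intros)
    from DERIV_mult[OF this I]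
    have D: "(E has_real_derivative exp (- (2 * L * t)) * (2 * (?d \<bullet> ?D) - 2 * L * (?d \<bullet> ?d))) (at t)"
      unfolding E_def by (rule DERIV_cong) (simp add: algebra_simps)
    have "?d \<bullet> ?D \<le> norm ?d * (L * norm ?d)"
      by (rule order_trans[OF norm_cauchy_schwarz]) (intro mult_left_mono L norm_ge_zero)
    also have "\<dots> = L * (?d \<bullet> ?d)" by (simp add: dot_square_norm power2_eq_square)
    finally have "exp (- (2 * L * t)) * (2 * (?d \<bullet> ?D) - 2 * L * (?d \<bullet> ?d)) \<le> 0"
      by (intro mult_nonneg_nonpos) auto
    with D show "\<exists>z. (E has_real_derivative z) (at t) \<and> z \<le> 0" by blast
  qed
  then have "(x s - y s) \<bullet> (x s - y s) \<le> 0"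
    by (simp add: E_def init mult_le_0_iff)
  then have "(x s - y s) \<bullet> (x s - y s) = 0"
    using inner_ge_zero[of "x s - y s"] by linarith
  then show ?thesis by simp
qed

text \<open>Picard iteration. Measured against the weight \<open>exp (2 \<Lambda> t)\<close>, the Picard map \<open>P\<close> contracts by the
  factor \<open>1/2\<close> on the whole interval \<open>[0,1]\<close>, whatever the size of the Lipschitz constant.\<close>

lemma Lipschitz_ode_exists:
  fixes G :: "'v::euclidean_space \<Rightarrow> 'v"
  assumes L: "\<And>u v. norm (G u - G v) \<le> L * norm (u - v)"
  shows "\<exists>x. continuous_on {0..1::real} x \<and> x 0 = y \<and>
    (\<forall>t\<in>{0<..<1}. (x has_vector_derivative G (x t)) (at t))"
proof -
  (* The lower bound 1 only serves to have a positive constant to divide by. *)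
  define \<Lambda> where "\<Lambda> = max L 1"
  have \<Lambda>: "0 < \<Lambda>" by (simp add: \<Lambda>_def)
  have Lip: "norm (G u - G v) \<le> \<Lambda> * norm (u - v)" for u v
    using L[of u v] by (rule order_trans) (auto simp: \<Lambda>_def intro!: mult_right_mono)
  have contG: "continuous_on S G" for S
  proof -
    have "\<Lambda>-lipschitz_on S G" using Lip \<Lambda> by (intro lipschitz_onI) (auto simp: dist_norm)
    then show ?thesis by (rule lipschitz_on_continuous_on)
  qed
  define P where "P x t = y + integral {0..t} (\<lambda>s. G (x s))" for x :: "real \<Rightarrow> 'v" and t
  define X where "X n = (P ^^ n) (\<lambda>_. y)" for n
  have X0: "X 0 = (\<lambda>_. y)" and XSuc: "X (Suc n) = P (X n)" for n by (simp_all add: X_def)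
  have contGx: "continuous_on {0..t} (\<lambda>s. G (x s))" if "continuous_on {0..1} x" "t \<le> 1" for x and t :: real
    by (intro continuous_on_compose2[OF contG continuous_on_subset[OF that(1)]]) (use that in auto)
  have intG: "(\<lambda>s. G (x s)) integrable_on {0..t}" if "continuous_on {0..1} x" "t \<le> 1" for x and t :: real
    by (rule integrable_continuous_real[OF contGx[OF that]])
  have contP: "continuous_on {0..1} (P x)" if "continuous_on {0..1} x" for x
    unfolding P_def by (intro continuous_intros indefinite_integral_continuous_1 intG that) auto
  have contX: "continuous_on {0..1} (X n)" for n
    by (induction n) (auto simp: X0 XSuc intro: contP)
  have P_diff: "norm (P x t - P z t) \<le> integral {0..t} (\<lambda>s. \<Lambda> * e s)"
    if "continuous_on {0..1} x" "continuous_on {0..1} z" "t \<in> {0..1}" "continuous_on {0..1} e"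
      "\<And>s. s \<in> {0..1} \<Longrightarrow> norm (x s - z s) \<le> e s" for x z t and e :: "real \<Rightarrow> real"
  proof -
    have "P x t - P z t = integral {0..t} (\<lambda>s. G (x s) - G (z s))"
      unfolding P_def using that by (subst integral_diff) (auto intro: intG)
    also have "norm \<dots> \<le> integral {0..t} (\<lambda>s. \<Lambda> * e s)"
    proof (rule integral_norm_bound_integral)
      show "(\<lambda>s. G (x s) - G (z s)) integrable_on {0..t}"
        using that by (intro integrable_diff intG) auto
      show "(\<lambda>s. \<Lambda> * e s) integrable_on {0..t}"
        using that by (intro integrable_continuous_real continuous_intros continuous_on_subset[OF that(4)]) auto
      fix s assume "s \<in> {0..t}"
      then show "norm (G (x s) - G (z s)) \<le> \<Lambda> * e s"
        using that \<Lambda> by (intro order_trans[OF Lip mult_left_mono]) auto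
    qed
    finally show ?thesis .
  qed
  define B where "B = norm (G y)"
  have step: "norm (X (Suc n) t - X n t) \<le> B * (1/2) ^ n * exp (2 * \<Lambda> * t)" if "t \<in> {0..1}" for n t
    using that
  proof (induction n arbitrary: t)
    case 0
    have "norm (X (Suc 0) t - X 0 t) = t * B"
      using 0 by (simp add: X0 XSuc P_def B_def)
    also have "\<dots> \<le> exp (2 * \<Lambda> * t) * B"
    proof (rule mult_right_mono)
      have "t \<le> 1" "1 \<le> exp (2 * \<Lambda> * t)" using 0 \<Lambda> by auto
      then show "t \<le> exp (2 * \<Lambda> * t)" by linarith
    qed (simp add: B_def)
    finally show ?case by (simp add: mult.commute)
  next
    case (Suc n)
    let ?c = "B * (1/2) ^ n"
    have t: "0 \<le> t" "t \<le> 1" using Suc.prems by auto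
    have "norm (X (Suc (Suc n)) t - X (Suc n) t) = norm (P (X (Suc n)) t - P (X n) t)"
      by (simp add: XSuc)
    also have "\<dots> \<le> integral {0..t} (\<lambda>s. \<Lambda> * (?c * exp (2 * \<Lambda> * s)))"
      by (rule P_diff) (use Suc in \<open>auto intro!: contX continuous_intros\<close>)
    also have "\<dots> = ?c / 2 * exp (2 * \<Lambda> * t) - ?c / 2 * exp (2 * \<Lambda> * 0)"
    proof (rule integral_unique[OF fundamental_theorem_of_calculus[OF t(1)]])
      fix s
      show "((\<lambda>s. ?c / 2 * exp (2 * \<Lambda> * s)) has_vector_derivative \<Lambda> * (?c * exp (2 * \<Lambda> * s))) (at s within {0..t})"
        unfolding has_real_derivative_iff_has_vector_derivative[symmetric]
        by (auto intro!: derivative_eq_intros)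
    qed
    also have "\<dots> \<le> B * (1/2) ^ Suc n * exp (2 * \<Lambda> * t)"
      by (simp add: B_def)
    finally show ?case .
  qed
  define x where "x t = y + (\<Sum>n. X (Suc n) t - X n t)" for t
  have lim: "uniform_limit {0..1} X x sequentially"
  proof -
    have "uniform_limit {0..1} (\<lambda>n t. \<Sum>i<n. X (Suc i) t - X i t) (\<lambda>t. \<Sum>n. X (Suc n) t - X n t) sequentially"
    proof (rule Weierstrass_m_test)
      show "summable (\<lambda>n. B * exp (2 * \<Lambda>) * (1/2::real) ^ n)" by (intro summable_mult summable_geometric) simp
      fix n and t :: real assume t: "t \<in> {0..1}"
      have "B * (1/2) ^ n * exp (2 * \<Lambda> * t) \<le> B * (1/2) ^ n * exp (2 * \<Lambda>)"
        using t \<Lambda> by (intro mult_left_mono) (auto simp: B_def)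
      with step[OF t, of n] show "norm (X (Suc n) t - X n t) \<le> B * exp (2 * \<Lambda>) * (1/2) ^ n"
        by (simp add: mult_ac)
    qed
    from uniform_limit_add[OF uniform_limit_const[where c = "\<lambda>_. y"] this]
    moreover have "(\<lambda>n t. y + (\<Sum>i<n. X (Suc i) t - X i t)) = X"
      by (intro ext) (simp add: sum_lessThan_telescope[of "\<lambda>i. X i t" for t] X0)
    ultimately show ?thesis by (simp add: x_def[abs_def])
  qed
  have contx: "continuous_on {0..1} x"
    by (rule uniform_limit_theorem[OF _ lim]) (auto intro: contX always_eventually)
  have fixed: "x t = P x t" if t: "t \<in> {0..1}" for t
  proof (rule LIMSEQ_unique)
    show "(\<lambda>n. X (Suc n) t) \<longlonglongrightarrow> x t"
      using tendsto_uniform_limitI[OF lim t] by (rule LIMSEQ_Suc)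
    show "(\<lambda>n. X (Suc n) t) \<longlonglongrightarrow> P x t"
    proof (rule LIMSEQ_I)
      fix e :: real assume e: "0 < e"
      then have "\<forall>\<^sub>F n in sequentially. \<forall>s\<in>{0..1}. dist (X n s) (x s) < e / (2 * \<Lambda>)"
        using uniform_limitD[OF lim, of "e / (2 * \<Lambda>)"] \<Lambda> by simp
      then obtain n0 where n0: "\<And>n s. n0 \<le> n \<Longrightarrow> s \<in> {0..1} \<Longrightarrow> dist (X n s) (x s) < e / (2 * \<Lambda>)"
        unfolding eventually_sequentially by blast
      show "\<exists>n0. \<forall>n\<ge>n0. norm (X (Suc n) t - P x t) < e"
      proof (intro exI allI impI)
        fix n assume "n0 \<le> n"
        have "norm (X (Suc n) t - P x t) \<le> integral {0..t} (\<lambda>s. \<Lambda> * (e / (2 * \<Lambda>)))"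
          unfolding XSuc
          by (rule P_diff) (use n0[OF \<open>n0 \<le> n\<close>] t in \<open>auto simp: dist_norm intro: contX contx less_imp_le\<close>)
        also have "\<dots> = t * (e / 2)" using t \<Lambda> by simp
        also have "\<dots> \<le> 1 * (e / 2)" using t e by (intro mult_right_mono) auto
        also have "\<dots> < e" using e by simp
        finally show "norm (X (Suc n) t - P x t) < e" .
      qed
    qed
  qed
  show ?thesis
  proof (intro exI[of _ x] conjI ballI contx)
    show "x 0 = y" using fixed[of 0] by (simp add: P_def)
    fix t :: real assume t: "t \<in> {0<..<1}"
    have "((\<lambda>t. integral {0..t} (\<lambda>s. G (x s))) has_vector_derivative G (x t)) (at t within {0..1})"
      by (rule integral_has_vector_derivative) (use t in \<open>auto intro: contGx contx\<close>)
    then have "(P x has_vector_derivative G (x t)) (at t within {0..1})"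
      unfolding P_def by (auto intro!: derivative_eq_intros)
    then have "(P x has_vector_derivative G (x t)) (at t within {0<..<1})"
      by (rule has_vector_derivative_within_subset) auto
    then have "(P x has_vector_derivative G (x t)) (at t)"
      unfolding at_within_open[OF t open_greaterThanLessThan] .
    then show "(x has_vector_derivative G (x t)) (at t)"
      by (rule has_vector_derivative_transform_within_open[where S = "{0<..<1}"])
         (use t in \<open>auto intro!: fixed[symmetric]\<close>)
  qed
qed

section \<open>The flow of the interpolated equation\<close>

lemma time_partition_mono:
  assumes "time_partition T N t" and "i \<le> j" and "j \<le> N"
  shows "t i \<le> t j"
  using assms(2,3)
proof (induction j rule: dec_induct)
  case base
  then show ?case by simp
next
  case (step k)
  then have "t i \<le> t k" "t k < t (Suc k)"
    using assms(1) by (auto simp: time_partition_def)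
  then show ?case by simp
qed

lemma interp_solution_restrict:
  assumes "interp_solution F Z N t r s Y" and "r \<le> r'" and "s' \<le> s"
  shows "interp_solution F Z N t r' s' Y"
  using assms unfolding interp_solution_def by (auto intro: continuous_on_subset)

text \<open>After rescaling a cell to unit length, the interpolated equation is the autonomous equation of this
  vector field, and a Runge-Kutta step on the cell is the step of length \<open>1\<close> for the same field.\<close>

definition cell_field ::
  "('m::finite \<Rightarrow> real^'e \<Rightarrow> real^'e) \<Rightarrow> (real \<Rightarrow> real^'m) \<Rightarrow> real \<Rightarrow> real \<Rightarrow> real^'e \<Rightarrow> real^'e" where
  "cell_field F Z u v x = (\<Sum>a\<in>UNIV. (Z v $ a - Z u $ a) *\<^sub>R F a x)"

lemma cell_field_scaled:
  "(\<Sum>a\<in>UNIV. ((Z v $ a - Z u $ a) / h) *\<^sub>R F a x) = (1 / h) *\<^sub>R cell_field F Z u v x"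
  by (simp add: cell_field_def scaleR_sum_right)

text \<open>The function \<open>interp_flow\<close> is a definite description; existence and uniqueness of solutions, cell by
  cell, give it a meaning and the flow property.\<close>

locale interpolated_equation =
  fixes T :: real and N :: nat and t :: "nat \<Rightarrow> real"
    and F :: "'m::finite \<Rightarrow> real^'e \<Rightarrow> real^'e" and Z :: "real \<Rightarrow> real^'m"
  assumes partition: "time_partition T N t"
    and Lipschitz: "n < N \<Longrightarrow> \<exists>L. \<forall>x y. norm (cell_field F Z (t n) (t (Suc n)) x - cell_field F Z (t n) (t (Suc n)) y) \<le> L * norm (x - y)"
begin

lemma step_pos: "n < N \<Longrightarrow> t n < t (Suc n)"
  using partition by (simp add: time_partition_def)

lemmas grid_mono = time_partition_mono[OF partition]

lemma solution_unique:
  assumes "n \<le> m" and "m \<le> N"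
    and "interp_solution F Z N t (t n) (t m) Y" and "interp_solution F Z N t (t n) (t m) W"
    and "Y (t n) = W (t n)"
  shows "Y (t m) = W (t m)"
  using assms(1-4)
proof (induction m rule: dec_induct)
  case base
  show ?case by (fact assms(5))
next
  case (step m)
  have m: "m < N" using step.prems by simp
  have le: "t n \<le> t m" "t m \<le> t (Suc m)" using step.hyps m by (auto intro!: grid_mono)
  let ?G = "\<lambda>x. (1 / (t (Suc m) - t m)) *\<^sub>R cell_field F Z (t m) (t (Suc m)) x"
  obtain L where L: "norm (cell_field F Z (t m) (t (Suc m)) x - cell_field F Z (t m) (t (Suc m)) y) \<le> L * norm (x - y)" for x y
    using Lipschitz[OF m] by blast
  have "norm (?G x - ?G y) \<le> (1 / (t (Suc m) - t m) * L) * norm (x - y)" for x y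
    using L[of x y] step_pos[OF m]
    by (simp flip: scaleR_diff_right) (simp add: divide_right_mono)
  moreover note \<open>t m \<le> t (Suc m)\<close>
  moreover have sol: "interp_solution F Z N t (t m) (t (Suc m)) Y" "interp_solution F Z N t (t m) (t (Suc m)) W"
    using step.prems le by (auto intro: interp_solution_restrict)
  then have "continuous_on {t m..t (Suc m)} Y" "continuous_on {t m..t (Suc m)} W"
    by (auto simp: interp_solution_def)
  moreover have "(Y has_vector_derivative ?G (Y u)) (at u)" "(W has_vector_derivative ?G (W u)) (at u)"
    if "u \<in> {t m<..<t (Suc m)}" for u
    using sol m that unfolding interp_solution_def cell_field_scaled by auto
  moreover have "Y (t m) = W (t m)"
    using step le by (auto intro: interp_solution_restrict)
  ultimately show ?case by (rule Lipschitz_ode_unique)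
qed

lemma interp_flow_eq:
  assumes "n \<le> m" and "m \<le> N" and "interp_solution F Z N t (t n) (t m) Y"
  shows "interp_flow F Z N t (t n) (t m) (Y (t n)) = Y (t m)"
  unfolding interp_flow_def using assms solution_unique by (intro the_equality) auto

lemma cell_solution_exists:
  assumes n: "n < N"
  shows "\<exists>x. continuous_on {0..1::real} x \<and> x 0 = y \<and>
    (\<forall>\<theta>\<in>{0<..<1}. (x has_vector_derivative cell_field F Z (t n) (t (Suc n)) (x \<theta>)) (at \<theta>))"
  using Lipschitz[OF n] Lipschitz_ode_exists by blast

text \<open>Solutions on successive cells are glued at the grid points.\<close>

lemma solution_exists:
  assumes "n \<le> m" and "m \<le> N"
  shows "\<exists>Y. interp_solution F Z N t (t n) (t m) Y \<and> Y (t n) = y"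
  using assms
proof (induction m rule: dec_induct)
  case base
  show ?case
    by (rule exI[of _ "\<lambda>_. y"]) (auto simp: interp_solution_def)
next
  case (step m)
  have m: "m < N" using step.prems by simp
  have le: "t n \<le> t m" "t m < t (Suc m)" using step.hyps m by (auto intro!: grid_mono step_pos)
  define h where "h = t (Suc m) - t m"
  have h: "0 < h" using le by (simp add: h_def)
  from step m obtain Y where Y: "interp_solution F Z N t (t n) (t m) Y" "Y (t n) = y" by auto
  obtain x where x: "continuous_on {0..1::real} x" "x 0 = Y (t m)"
    "\<And>\<theta>. \<theta> \<in> {0<..<1} \<Longrightarrow> (x has_vector_derivative cell_field F Z (t m) (t (Suc m)) (x \<theta>)) (at \<theta>)"
    using cell_solution_exists[OF m] by blast
  define c where "c u = x ((u - t m) / h)" for u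
  define W where "W u = (if u \<le> t m then Y u else c u)" for u
  have contY: "continuous_on {t n..t m} Y" using Y by (simp add: interp_solution_def)
  have contc: "continuous_on {t m..t (Suc m)} c"
    unfolding c_def
    by (rule continuous_on_compose2[OF x(1)]) (use h in \<open>auto intro!: continuous_intros simp: h_def\<close>)
  have "continuous_on ({t n..t m} \<union> {t m..t (Suc m)}) W"
    unfolding W_def using contY contc x(2)
    by (intro continuous_on_If) (auto simp: c_def)
  moreover have "{t n..t m} \<union> {t m..t (Suc m)} = {t n..t (Suc m)}" using le by auto
  ultimately have contW: "continuous_on {t n..t (Suc m)} W" by simp
  have derivW: "(W has_vector_derivative
      (\<Sum>a\<in>UNIV. ((Z (t (Suc j)) $ a - Z (t j) $ a) / (t (Suc j) - t j)) *\<^sub>R F a (W u))) (at u)"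
    if j: "j < N" and u: "u \<in> {t j<..<t (Suc j)} \<inter> {t n<..<t (Suc m)}" for j u
  proof -
    consider "j < m" | "j = m" | "Suc m \<le> j" by linarith
    then show ?thesis
    proof cases
      case 1
      then have "t (Suc j) \<le> t m" using m by (intro grid_mono) auto
      then have u': "u < t m" using u by auto
      have "(Y has_vector_derivative
        (\<Sum>a\<in>UNIV. ((Z (t (Suc j)) $ a - Z (t j) $ a) / (t (Suc j) - t j)) *\<^sub>R F a (Y u))) (at u)"
        using Y(1) j u u' unfolding interp_solution_def by auto
      moreover have "W u = Y u" using u' by (simp add: W_def)
      ultimately show ?thesis
        using u' by (auto intro: has_vector_derivative_transform_within_open[where S = "{..<t m}"] simp: W_def)
    next
      case 2
      have u': "t m < u" "u < t (Suc m)" using u 2 by auto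
      have \<theta>: "(u - t m) / h \<in> {0<..<1}" using u' h by (simp add: h_def)
      have "((\<lambda>u. (u - t m) / h) has_vector_derivative 1 / h) (at u)"
        unfolding has_real_derivative_iff_has_vector_derivative[symmetric]
        using h by (auto intro!: derivative_eq_intros)
      from vector_diff_chain_at[OF this x(3)[OF \<theta>]]
      have "(c has_vector_derivative (1 / h) *\<^sub>R cell_field F Z (t m) (t (Suc m)) (c u)) (at u)"
        by (simp add: c_def[abs_def] o_def)
      moreover have "W u = c u" using u' by (simp add: W_def)
      ultimately show ?thesis
        unfolding cell_field_scaled 2 h_def[symmetric]
        using u' by (auto intro: has_vector_derivative_transform_within_open[where S = "{t m<..}"] simp: W_def)
    next
      case 3
      then have "t (Suc m) \<le> t j" using j by (intro grid_mono) auto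
      then show ?thesis using u by auto
    qed
  qed
  have "interp_solution F Z N t (t n) (t (Suc m)) W"
    unfolding interp_solution_def using contW derivW by auto
  moreover have "W (t n) = y" using Y le by (simp add: W_def)
  ultimately show ?case by blast
qed

lemma interp_flow_same: "n \<le> N \<Longrightarrow> interp_flow F Z N t (t n) (t n) y = y"
  using interp_flow_eq[of n n "\<lambda>_. y"] by (simp add: interp_solution_def)

lemma interp_flow_compose:
  assumes "n < m" and "m \<le> N"
  shows "interp_flow F Z N t (t n) (t m) y
    = interp_flow F Z N t (t (Suc n)) (t m) (interp_flow F Z N t (t n) (t (Suc n)) y)"
proof -
  obtain Y where Y: "interp_solution F Z N t (t n) (t m) Y" "Y (t n) = y"
    using solution_exists[of n m y] assms by auto
  have le: "t n \<le> t (Suc n)" "t (Suc n) \<le> t m" using assms by (auto intro!: grid_mono)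
  have "interp_flow F Z N t (t n) (t (Suc n)) (Y (t n)) = Y (t (Suc n))"
    "interp_flow F Z N t (t (Suc n)) (t m) (Y (t (Suc n))) = Y (t m)"
    "interp_flow F Z N t (t n) (t m) (Y (t n)) = Y (t m)"
    using assms Y le by (auto intro!: interp_flow_eq intro: interp_solution_restrict)
  then show ?thesis using Y by simp
qed

text \<open>The form in which the flow over one cell meets the local error estimate: as the value at time \<open>1\<close> of
  the rescaled solution.\<close>

lemma interp_flow_cell:
  assumes n: "n < N"
  shows "\<exists>x. continuous_on {0..1::real} x \<and> x 0 = y \<and>
    (\<forall>\<theta>\<in>{0<..<1}. (x has_vector_derivative cell_field F Z (t n) (t (Suc n)) (x \<theta>)) (at \<theta>)) \<and>
    x 1 = interp_flow F Z N t (t n) (t (Suc n)) y"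
proof -
  define h where "h = t (Suc n) - t n"
  have h: "0 < h" using step_pos[OF n] by (simp add: h_def)
  obtain Y where Y: "interp_solution F Z N t (t n) (t (Suc n)) Y" "Y (t n) = y"
    using solution_exists[of n "Suc n" y] n by auto
  define x where "x \<theta> = Y (t n + \<theta> * h)" for \<theta>
  have contY: "continuous_on {t n..t (Suc n)} Y" using Y by (simp add: interp_solution_def)
  have tSuc: "t (Suc n) = t n + h" by (simp add: h_def)
  have inside: "t n + \<theta> * h \<in> {t n..t (Suc n)}" if "\<theta> \<in> {0..1}" for \<theta>
    using that h mult_right_mono[of \<theta> 1 h] by (auto simp: tSuc)
  have inside': "t n + \<theta> * h \<in> {t n<..<t (Suc n)}" if "\<theta> \<in> {0<..<1}" for \<theta>
    using that h mult_strict_right_mono[of \<theta> 1 h] by (auto simp: tSuc)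
  show ?thesis
  proof (intro exI[of _ x] conjI ballI)
    show "continuous_on {0..1} x"
      unfolding x_def by (rule continuous_on_compose2[OF contY]) (use inside in \<open>auto intro!: continuous_intros\<close>)
    show "x 0 = y" using Y by (simp add: x_def)
    show "x 1 = interp_flow F Z N t (t n) (t (Suc n)) y"
      using interp_flow_eq[OF _ _ Y(1)] n Y(2) by (simp add: x_def h_def)
    fix \<theta> :: real assume \<theta>: "\<theta> \<in> {0<..<1}"
    have Y': "(Y has_vector_derivative (1 / h) *\<^sub>R cell_field F Z (t n) (t (Suc n)) (x \<theta>)) (at (t n + \<theta> * h))"
    proof -
      have "(Y has_vector_derivative (1 / h) *\<^sub>R cell_field F Z (t n) (t (Suc n)) (Y u)) (at u)"
        if "u \<in> {t n<..<t (Suc n)}" for u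
        using Y(1) n that unfolding interp_solution_def cell_field_scaled h_def by auto
      from this[OF inside'[OF \<theta>]] show ?thesis by (simp add: x_def)
    qed
    have "((\<lambda>\<theta>. t n + \<theta> * h) has_vector_derivative h) (at \<theta>)"
      unfolding has_real_derivative_iff_has_vector_derivative[symmetric]
      by (auto intro!: derivative_eq_intros)
    from vector_diff_chain_at[OF this Y']
    show "(x has_vector_derivative cell_field F Z (t n) (t (Suc n)) (x \<theta>)) (at \<theta>)"
      using h by (simp add: x_def[abs_def] o_def)
  qed
qed

text \<open>Lady Windermere's fan: \<open>Y (t m)\<close> and \<open>y m\<close> are the first and the last term of the sequence obtained
  by following the flow to \<open>t m\<close> from the successive numerical values \<open>y n\<close>. Neighbouring terms differ
  by a local error that has been transported by the flow.\<close>

lemma global_error_telescope: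
  assumes stable: "\<And>r s y y'. 0 \<le> r \<Longrightarrow> r \<le> s \<Longrightarrow> s \<le> T \<Longrightarrow> y \<in> B \<Longrightarrow> y' \<in> B \<Longrightarrow>
      norm (interp_flow F Z N t r s y - interp_flow F Z N t r s y') \<le> L * norm (y - y')"
    and inB: "\<And>n. n < N \<Longrightarrow> interp_flow F Z N t (t n) (t (Suc n)) (y n) \<in> B \<and> y (Suc n) \<in> B"
    and Y: "interp_solution F Z N t 0 T Y" "Y 0 = y 0"
    and m: "m \<le> N"
  shows "norm (Y (t m) - y m) \<le> (\<Sum>n<m. L * norm (interp_flow F Z N t (t n) (t (Suc n)) (y n) - y (Suc n)))"
proof -
  let ?\<phi> = "\<lambda>n m. interp_flow F Z N t (t n) (t m)"
  have t0: "t 0 = 0" and tN: "t N = T" using partition by (auto simp: time_partition_def)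
  have "norm (Y (t m) - ?\<phi> n m (y n)) \<le> (\<Sum>k<n. L * norm (?\<phi> k (Suc k) (y k) - y (Suc k)))"
    if "n \<le> m" for n
    using that
  proof (induction n)
    case 0
    have "interp_solution F Z N t (t 0) (t m) Y"
      using interp_solution_restrict[OF Y(1), of 0 "t m"] grid_mono[of m N] m t0 tN by simp
    then have "?\<phi> 0 m (Y (t 0)) = Y (t m)"
      using m by (intro interp_flow_eq) auto
    then show ?case using Y(2) t0 by simp
  next
    case (Suc n)
    have nN: "n < N" using Suc.prems m by simp
    have "?\<phi> n m (y n) = ?\<phi> (Suc n) m (?\<phi> n (Suc n) (y n))"
      using Suc.prems m by (intro interp_flow_compose) auto
    moreover have "norm (?\<phi> (Suc n) m (?\<phi> n (Suc n) (y n)) - ?\<phi> (Suc n) m (y (Suc n)))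
        \<le> L * norm (?\<phi> n (Suc n) (y n) - y (Suc n))"
      using Suc.prems m inB[OF nN] grid_mono[of 0 "Suc n"] grid_mono[of "Suc n" m] grid_mono[of m N] t0 tN
      by (intro stable) auto
    ultimately have "norm (?\<phi> n m (y n) - ?\<phi> (Suc n) m (y (Suc n))) \<le> L * norm (?\<phi> n (Suc n) (y n) - y (Suc n))"
      by simp
    with Suc show ?case
      using norm_diff_triangle_le[of "Y (t m)" "?\<phi> n m (y n)" _ "?\<phi> (Suc n) m (y (Suc n))"] by simp
  qed
  from this[of m] show ?thesis by (simp add: interp_flow_same m)
qed

end

section \<open>The global error\<close>

lemma Cb_family_deriv_bound:
  fixes F :: "'i::finite \<Rightarrow> 'a::euclidean_space \<Rightarrow> 'b::euclidean_space"
  assumes "\<And>i. Cb n (F i)"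
  shows "\<exists>M\<ge>0. \<forall>i. deriv_bound n M (F i)"
proof -
  have "\<forall>i j. \<exists>M. j \<le> n \<longrightarrow> (\<forall>vs x. length vs = j \<longrightarrow> norm (iter_deriv (F i) vs x) \<le> M * prod_list (map norm vs))"
    using assms unfolding Cb_def by blast
  then obtain M where M: "\<And>i vs x. length vs \<le> n \<Longrightarrow>
      norm (iter_deriv (F i) vs x) \<le> M i (length vs) * prod_list (map norm vs)"
    by metis
  define B where "B = (\<Sum>i\<in>UNIV. \<Sum>j\<le>n. \<bar>M i j\<bar>)"
  have "deriv_bound n B (F i)" for i
    unfolding deriv_bound_def
  proof (intro conjI allI impI)
    show "iter_deriv (F i) vs differentiable (at x)" if "length vs < n" for vs x
      using assms that by (auto simp: Cb_def)
    fix vs :: "'a list" and x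
    assume len: "length vs \<le> n"
    have "M i (length vs) \<le> \<bar>M i (length vs)\<bar>" by simp
    also have "\<dots> \<le> (\<Sum>j\<le>n. \<bar>M i j\<bar>)"
      using len by (intro member_le_sum) auto
    also have "\<dots> \<le> B"
      unfolding B_def by (rule member_le_sum[where f = "\<lambda>i. \<Sum>j\<le>n. \<bar>M i j\<bar>"]) (auto intro: sum_nonneg)
    finally have "M i (length vs) * prod_list (map norm vs) \<le> B * prod_list (map norm vs)"
      by (rule mult_right_mono) (induction vs, auto)
    with M[OF len] show "norm (iter_deriv (F i) vs x) \<le> B * prod_list (map norm vs)"
      by (rule order_trans)
  qed
  moreover have "0 \<le> B" by (auto simp: B_def intro!: sum_nonneg)
  ultimately show ?thesis by blast
qed

lemma sum_abs_component_le: "(\<Sum>a\<in>UNIV. \<bar>x $ a\<bar>) \<le> real CARD('m) * norm x" for x :: "real^'m"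
proof -
  have "(\<Sum>a\<in>UNIV. \<bar>x $ a\<bar>) \<le> (\<Sum>a\<in>(UNIV :: 'm set). norm x)"
    by (rule sum_mono) (rule component_le_norm_cart)
  then show ?thesis by simp
qed

lemma le_mesh: "n < N \<Longrightarrow> t (Suc n) - t n \<le> mesh N t"
  unfolding mesh_def by (rule Max_ge) auto

text \<open>Of the exponent \<open>\<rho>\<close>, one unit is spent on summing the step lengths to at most \<open>T\<close>; the rest is gained
  from the mesh.\<close>

lemma sum_step_powr_le:
  assumes part: "time_partition T N t" and "1 \<le> \<rho>" and "m \<le> N"
  shows "(\<Sum>n<m. (t (Suc n) - t n) powr \<rho>) \<le> T * mesh N t powr (\<rho> - 1)"
proof -
  have "(\<Sum>n<m. (t (Suc n) - t n) powr \<rho>) \<le> (\<Sum>n<m. (t (Suc n) - t n) * mesh N t powr (\<rho> - 1))"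
  proof (rule sum_mono)
    fix n assume "n \<in> {..<m}"
    then have n: "n < N" using \<open>m \<le> N\<close> by simp
    have h: "0 < t (Suc n) - t n" using part n by (simp add: time_partition_def)
    have "(t (Suc n) - t n) powr \<rho> = (t (Suc n) - t n) powr (1 + (\<rho> - 1))" by simp
    also have "\<dots> = (t (Suc n) - t n) * (t (Suc n) - t n) powr (\<rho> - 1)"
      using h by (simp only: powr_add powr_one)
    also have "\<dots> \<le> (t (Suc n) - t n) * mesh N t powr (\<rho> - 1)"
      using h le_mesh[OF n, of t] \<open>1 \<le> \<rho>\<close> by (intro mult_left_mono powr_mono2) auto
    finally show "(t (Suc n) - t n) powr \<rho> \<le> (t (Suc n) - t n) * mesh N t powr (\<rho> - 1)" .
  qed
  also have "\<dots> = (t m - t 0) * mesh N t powr (\<rho> - 1)"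
    by (simp add: sum_lessThan_telescope[of t] flip: sum_distrib_right)
  also have "\<dots> \<le> T * mesh N t powr (\<rho> - 1)"
    using time_partition_mono[OF part \<open>m \<le> N\<close>] part
    by (intro mult_right_mono) (auto simp: time_partition_def)
  finally show ?thesis .
qed

theorem theorem6p4:
  fixes \<alpha> T R :: real
    and p :: nat
    and Y0 :: "real^'e"
    and F :: "'m::finite \<Rightarrow> real^'e \<Rightarrow> real^'e"
    and X :: "real \<Rightarrow> real^'d"
    and XX :: "real \<Rightarrow> real \<Rightarrow> real^'d^'d"
    and Z :: "real \<Rightarrow> real^'m"
    and Z' :: "real \<Rightarrow> real^'d^'m"
    and A :: "real^'q^'q"
    and b :: "real^'q"
    and K :: "real \<Rightarrow> real \<Rightarrow> real^'e \<Rightarrow> real^'e^'q"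
  assumes "1 / 3 < \<alpha>" and "\<alpha> \<le> 1 / 2" and "T > 0" and "R > 0"
    and "(real p + 1) * \<alpha> > 1"
    and "\<forall>a. Cb (p + 1) (F a)"
    and "rough_path \<alpha> T X XX"
    and "controlled_path \<alpha> T X Z Z'"
    and tree_order_p: "\<forall>\<tau> :: 'm dtree. tree_order \<tau> \<le> p \<longrightarrow> tree_coeff A b \<tau> = 1 / real (tree_fact \<tau>)"
    and flow_stability:
      "\<forall>R'>0. \<exists>L>0. \<forall>N t. time_partition T N t \<longrightarrow>
         (\<forall>r s y y'. 0 \<le> r \<and> r \<le> s \<and> s \<le> T \<and> y \<in> cball 0 R' \<and> y' \<in> cball 0 R' \<longrightarrow>
            norm (interp_flow F Z N t r s y - interp_flow F Z N t r s y') \<le> L * norm (y - y'))"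
  shows "\<exists>C>0. \<forall>N t y Yh.
     time_partition T N t \<and>
     y = scrk_iterate b F Z K t Y0 \<and>
     (\<forall>n<N. scrk_stages A F Z (t n) (t (Suc n)) (y n) (K (t n) (t (Suc n)) (y n))) \<and>
     (\<forall>n<N. y n \<in> cball 0 R \<and>
        interp_flow F Z N t (t n) (t (Suc n)) (y n) \<in> cball 0 R \<and>
        scrk_step b F Z K (t n) (t (Suc n)) (y n) \<in> cball 0 R) \<and>
     interp_solution F Z N t 0 T Yh \<and> Yh 0 = Y0
     \<longrightarrow> Max ((\<lambda>n. norm (Yh (t n) - y n)) ` {0..N}) \<le> C * mesh N t powr ((real p + 1) * \<alpha> - 1)"
proof -
  have F: "\<And>a. Cb (p + 1) (F a)" and gt: "(real p + 1) * \<alpha> > 1" using assms by auto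
  let ?\<rho> = "(real p + 1) * \<alpha>"
  obtain M where M: "0 \<le> M" "\<And>a. deriv_bound (p + 1) M (F a)"
    using Cb_family_deriv_bound[of "p + 1" F] F by auto
  obtain H where H: "\<And>s t. s \<in> {0..T} \<Longrightarrow> t \<in> {0..T} \<Longrightarrow> norm (Z t - Z s) \<le> H * \<bar>t - s\<bar> powr \<alpha>"
    using \<open>controlled_path \<alpha> T X Z Z'\<close> unfolding controlled_path_def hoelder_on_def by blast
  obtain L where L: "0 < L" "\<And>N t r s y y'. time_partition T N t \<Longrightarrow> 0 \<le> r \<Longrightarrow> r \<le> s \<Longrightarrow> s \<le> T \<Longrightarrow>
      y \<in> cball 0 R \<Longrightarrow> y' \<in> cball 0 R \<Longrightarrow>
      norm (interp_flow F Z N t r s y - interp_flow F Z N t r s y') \<le> L * norm (y - y')"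
    using flow_stability \<open>R > 0\<close> by meson
  obtain C where C: "0 \<le> C" "\<And>(G :: real^'e \<Rightarrow> real^'e) M y k x. deriv_bound p M G \<Longrightarrow>
      (\<forall>i. k i = y + (\<Sum>j\<in>UNIV. (A $ i $ j) *\<^sub>R G (k j))) \<Longrightarrow>
      continuous_on {0..1} x \<Longrightarrow> (\<forall>t\<in>{0<..<1}. (x has_vector_derivative G (x t)) (at t)) \<Longrightarrow> x 0 = y \<Longrightarrow>
      norm (x 1 - (y + (\<Sum>i\<in>UNIV. (b $ i) *\<^sub>R G (k i)))) \<le> C * M ^ Suc p"
    using runge_kutta_local_error[OF tree_order_p[rule_format], where 'v="real^'e"] by blast
  define D where "D = C * (M * (real CARD('m) * \<bar>H\<bar>)) ^ Suc p"
  have D: "0 \<le> D" using C(1) M(1) by (simp add: D_def)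
  define const where "const = L * D * T + 1"
  have const: "0 < const" using L(1) D \<open>T > 0\<close> by (simp add: const_def add_nonneg_pos)
  show ?thesis
  proof (intro exI[of _ const] conjI const allI impI)
    fix N t y Yh
    assume *: "time_partition T N t \<and>
     y = scrk_iterate b F Z K t Y0 \<and>
     (\<forall>n<N. scrk_stages A F Z (t n) (t (Suc n)) (y n) (K (t n) (t (Suc n)) (y n))) \<and>
     (\<forall>n<N. y n \<in> cball 0 R \<and>
        interp_flow F Z N t (t n) (t (Suc n)) (y n) \<in> cball 0 R \<and>
        scrk_step b F Z K (t n) (t (Suc n)) (y n) \<in> cball 0 R) \<and>
     interp_solution F Z N t 0 T Yh \<and> Yh 0 = Y0"
    from * have part: "time_partition T N t" and y: "y = scrk_iterate b F Z K t Y0"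
      and stages: "\<And>n. n < N \<Longrightarrow> scrk_stages A F Z (t n) (t (Suc n)) (y n) (K (t n) (t (Suc n)) (y n))"
      and sol: "interp_solution F Z N t 0 T Yh" "Yh 0 = Y0" by auto
    have y0: "y 0 = Y0" and ySuc: "y (Suc n) = scrk_step b F Z K (t n) (t (Suc n)) (y n)" for n
      by (simp_all add: y)
    have ball: "interp_flow F Z N t (t n) (t (Suc n)) (y n) \<in> cball 0 R \<and> y (Suc n) \<in> cball 0 R" if "n < N" for n
      using * that ySuc by auto
    let ?G = "\<lambda>n. cell_field F Z (t n) (t (Suc n))"
    (* m n bounds all derivatives of the field of the n-th cell; it is of the order of the increment
       of Z over that cell. *)
    define m where "m n = M * (\<Sum>a\<in>UNIV. \<bar>Z (t (Suc n)) $ a - Z (t n) $ a\<bar>)" for n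
    have G: "deriv_bound (p + 1) (m n) (?G n)" for n
      unfolding m_def cell_field_def[abs_def] using M(2) by (rule deriv_bound_linear_combination)
    interpret interpolated_equation T N t F Z
    proof
      show "\<exists>L. \<forall>x y. norm (?G n x - ?G n y) \<le> L * norm (x - y)" for n
        using deriv_bound_Lipschitz[of p "m n" "?G n"] G[of n] by auto
    qed (rule part)
    have local_error: "norm (interp_flow F Z N t (t n) (t (Suc n)) (y n) - y (Suc n))
        \<le> D * (t (Suc n) - t n) powr ?\<rho>" if n: "n < N" for n
    proof -
      define h where "h = t (Suc n) - t n"
      have h: "0 < h" using step_pos[OF n] by (simp add: h_def)
      define k where "k i = K (t n) (t (Suc n)) (y n) $ i" for i
      obtain x where x: "continuous_on {0..1::real} x" "x 0 = y n"
        "\<forall>\<theta>\<in>{0<..<1}. (x has_vector_derivative ?G n (x \<theta>)) (at \<theta>)"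
        "x 1 = interp_flow F Z N t (t n) (t (Suc n)) (y n)"
        using interp_flow_cell[OF n] by blast
      have stage: "\<forall>i. k i = y n + (\<Sum>j\<in>UNIV. (A $ i $ j) *\<^sub>R ?G n (k j))"
      proof
        fix i
        have "k i = y n + (\<Sum>a\<in>UNIV. \<Sum>j\<in>UNIV. (A $ i $ j * (Z (t (Suc n)) $ a - Z (t n) $ a)) *\<^sub>R F a (k j))"
          using stages[OF n] unfolding scrk_stages_def k_def by blast
        also have "\<dots> = y n + (\<Sum>j\<in>UNIV. (A $ i $ j) *\<^sub>R ?G n (k j))"
          by (subst sum.swap) (simp add: cell_field_def scaleR_sum_right)
        finally show "k i = y n + (\<Sum>j\<in>UNIV. (A $ i $ j) *\<^sub>R ?G n (k j))" .
      qed
      have y_next: "y (Suc n) = y n + (\<Sum>i\<in>UNIV. (b $ i) *\<^sub>R ?G n (k i))"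
        unfolding ySuc scrk_step_def k_def
        by (subst sum.swap) (simp add: cell_field_def scaleR_sum_right)
      have "norm (interp_flow F Z N t (t n) (t (Suc n)) (y n) - y (Suc n)) \<le> C * m n ^ Suc p"
        using C(2)[OF deriv_bound_le[OF G] stage x(1,3,2)] x(4) y_next by simp
      also have "\<dots> \<le> C * (M * (real CARD('m) * \<bar>H\<bar>) * h powr \<alpha>) ^ Suc p"
      proof (intro mult_left_mono power_mono C(1))
        have "t n \<in> {0..T}" "t (Suc n) \<in> {0..T}"
          using grid_mono[of 0 n] grid_mono[of n N] grid_mono[of 0 "Suc n"] grid_mono[of "Suc n" N] n part
          by (auto simp: time_partition_def)
        then have "norm (Z (t (Suc n)) - Z (t n)) \<le> H * h powr \<alpha>"
          using H[of "t n" "t (Suc n)"] h by (simp add: h_def)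
        also have "\<dots> \<le> \<bar>H\<bar> * h powr \<alpha>" by (intro mult_right_mono) auto
        finally have "real CARD('m) * norm (Z (t (Suc n)) - Z (t n)) \<le> real CARD('m) * (\<bar>H\<bar> * h powr \<alpha>)"
          by (intro mult_left_mono) auto
        then have "(\<Sum>a\<in>UNIV. \<bar>(Z (t (Suc n)) - Z (t n)) $ a\<bar>) \<le> real CARD('m) * (\<bar>H\<bar> * h powr \<alpha>)"
          by (rule order_trans[OF sum_abs_component_le])
        from mult_left_mono[OF this M(1)] show "m n \<le> M * (real CARD('m) * \<bar>H\<bar>) * h powr \<alpha>"
          by (simp add: m_def mult.assoc)
        show "0 \<le> m n" using M(1) by (simp add: m_def sum_nonneg)
      qed
      also have "\<dots> = D * (h powr \<alpha>) ^ Suc p"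
        by (simp only: D_def power_mult_distrib mult.assoc)
      also have "(h powr \<alpha>) ^ Suc p = h powr ?\<rho>"
      proof -
        have "(h powr \<alpha>) ^ Suc p = (h powr \<alpha>) powr real (Suc p)"
          using h by (subst powr_realpow) auto
        then show ?thesis by (simp add: powr_powr algebra_simps)
      qed
      finally show ?thesis by (simp add: h_def)
    qed
    have error: "norm (Yh (t i) - y i) \<le> const * mesh N t powr (?\<rho> - 1)" if i: "i \<le> N" for i
    proof -
      have "norm (Yh (t i) - y i) \<le> (\<Sum>n<i. L * norm (interp_flow F Z N t (t n) (t (Suc n)) (y n) - y (Suc n)))"
        by (rule global_error_telescope[OF L(2)[OF part] ball sol(1) _ i]) (auto simp: sol y0)
      also have "\<dots> \<le> (\<Sum>n<i. L * (D * (t (Suc n) - t n) powr ?\<rho>))"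
        using i L(1) by (intro sum_mono mult_left_mono local_error) auto
      also have "\<dots> = L * D * (\<Sum>n<i. (t (Suc n) - t n) powr ?\<rho>)"
        by (simp add: sum_distrib_left mult.assoc)
      also have "\<dots> \<le> L * D * (T * mesh N t powr (?\<rho> - 1))"
        using sum_step_powr_le[OF part _ i] gt L(1) D by (intro mult_left_mono) auto
      also have "\<dots> \<le> const * mesh N t powr (?\<rho> - 1)"
        by (simp add: const_def distrib_right mult.assoc)
      finally show ?thesis .
    qed
    show "Max ((\<lambda>n. norm (Yh (t n) - y n)) ` {0..N}) \<le> const * mesh N t powr (?\<rho> - 1)"
      using error by (intro Max.boundedI) auto
  qed
qed

end
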